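(* Let $k\ge n\ge 1$ and let $V\subset\mathbb{R}^n$ be a compact tropical prevariety given by a system of $k$ tropical polynomials in $n$ variables, with finite coefficients and of maximal tropical degree at most $d$. Then for every $0\le l\le n$ the $l$-th Betti number of $V$ does not exceed $$\left(\frac{d^n}{k-n+1}\binom{k+n-1}{n}\right)^{l+1}.$$
   Context: A tropical polynomial $f$ in $n$ variables is given by a nonempty finite set of tropical monomials $Q_j(x)=a_j+i_{j1}x_1+\cdots+i_{jn}x_n$ with $a_j\in\mathbb{R}$ and pairwise distinct exponent vectors $(i_{j1},\dots,i_{jn})\in\mathbb{Z}_{\ge 0}^n$; $f(x)=\min_j Q_j(x)$. The tropical degree of $Q_j$ is $i_{j1}+\cdots+i_{jn}$, and the tropical degree of $f$ is the maximum of the degrees of its monomials. A tropical polynomial of tropical degree $e$ has finite coefficients if every monomial of tropical degree at most $e$ occurs in it. A point $x\in\mathbb{R}^n$ is a tropical zero of $f$ if $\min_j Q_j(x)$ is attained for at least two different $j$. The tropical prevariety given by $f_1,\dots,f_k$ is the set of all $x\in\mathbb{R}^n$ that are tropical zeros of every $f_i$. *)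

theory Defs
  imports "HOL-Analysis.Analysis" "HOL-Homology.Homology"
begin

text \<open>
  A tropical polynomial in the variables indexed by \<open>'n\<close> maps each exponent vector occurring in it
  to the coefficient of its monomial; a partial map makes the exponent vectors of the
  monomials pairwise distinct by construction.
\<close>

type_synonym 'n trop_poly = "(nat ^ 'n) \<rightharpoonup> real"

definition is_trop_poly :: "'n::finite trop_poly \<Rightarrow> bool" where
  "is_trop_poly f \<longleftrightarrow> finite (dom f) \<and> dom f \<noteq> {}"

definition trop_monomial :: "'n::finite trop_poly \<Rightarrow> nat ^ 'n \<Rightarrow> real ^ 'n \<Rightarrow> real" where
  "trop_monomial f I x = the (f I) + (\<Sum>j\<in>UNIV. real (I $ j) * x $ j)"

definition trop_eval :: "'n::finite trop_poly \<Rightarrow> real ^ 'n \<Rightarrow> real" where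
  "trop_eval f x = Min ((\<lambda>I. trop_monomial f I x) ` dom f)"

definition monomial_degree :: "nat ^ 'n::finite \<Rightarrow> nat" where
  "monomial_degree I = (\<Sum>j\<in>UNIV. I $ j)"

definition trop_degree :: "'n::finite trop_poly \<Rightarrow> nat" where
  "trop_degree f = Max (monomial_degree ` dom f)"

definition finite_coefficients :: "'n::finite trop_poly \<Rightarrow> bool" where
  "finite_coefficients f \<longleftrightarrow> (\<forall>I. monomial_degree I \<le> trop_degree f \<longrightarrow> I \<in> dom f)"

definition trop_zero :: "'n::finite trop_poly \<Rightarrow> real ^ 'n \<Rightarrow> bool" where
  "trop_zero f x \<longleftrightarrow>
     (\<exists>I\<in>dom f. \<exists>J\<in>dom f. I \<noteq> J \<and>
        trop_monomial f I x = trop_eval f x \<and> trop_monomial f J x = trop_eval f x)"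

definition trop_prevariety :: "nat \<Rightarrow> (nat \<Rightarrow> 'n::finite trop_poly) \<Rightarrow> (real ^ 'n) set" where
  "trop_prevariety k F = {x. \<forall>i<k. trop_zero (F i) x}"

text \<open>
  The Betti numbers are the ranks of the integral singular homology groups. The abelian group
  \<open>G\<close> is written multiplicatively, so \<open>\<Otimes>b\<in>B. b [^] c b\<close> is the integer combination of \<open>B\<close> with
  coefficients \<open>c\<close>. The rank is the supremum of the cardinalities of the finite independent
  sets; it takes values in \<^typ>\<open>enat\<close> so that an infinite rank is \<open>\<infinity>\<close>, not \<open>0\<close>.
\<close>

definition int_independent :: "('a, 'b) monoid_scheme \<Rightarrow> 'a set \<Rightarrow> bool" where
  "int_independent G B \<longleftrightarrow> B \<subseteq> carrier G \<and>
     (\<forall>c :: 'a \<Rightarrow> int.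
        finprod G (\<lambda>b. b [^]\<^bsub>G\<^esub> c b) B = \<one>\<^bsub>G\<^esub> \<longrightarrow> (\<forall>b\<in>B. c b = 0))"

definition abelian_rank :: "('a, 'b) monoid_scheme \<Rightarrow> enat" where
  "abelian_rank G = (SUP B\<in>{B. finite B \<and> int_independent G B}. enat (card B))"

definition betti_number :: "nat \<Rightarrow> 'a::topological_space set \<Rightarrow> enat" where
  "betti_number l S = abelian_rank (homology_group (int l) (top_of_set S))"

end

theory Submission imports Defs begin

text \<open>
  Write \<open>n\<close> for the number of variables. Call two points of the prevariety \<open>V\<close> equivalent if the same
  monomials of each \<open>F i\<close> are minimal at both. The closures of the classes are polytopes, because \<open>V\<close>
  is compact, and with their faces they form a finite polytopal complex
  (\<open>polytopal_complex_pattern_cells\<close>). The bound combines a topological estimate for such complexes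
  with a count of the vertices of \<open>V\<close>.

  \<^bold>\<open>Topology.\<close> Attaching an \<open>m\<close>-dimensional convex cell along its relative boundary raises the \<open>m\<close>-th
  Betti number by at most one and no other (\<open>betti_number_attach_cell\<close>). So the \<open>l\<close>-th Betti number is
  at most the number of \<open>l\<close>-dimensional cells (\<open>betti_number_polytopal_complex\<close>). A cell of dimension \<open>l\<close>
  is determined by any \<open>l + 1\<close> affinely independent vertices of it, so with \<open>w\<close> vertices there are at
  most \<open>w ^ (l + 1)\<close> of these (\<open>card_faces_le_vertices_power\<close>). It remains to show that
  \<open>w * (k - n + 1) \<le> ((k + n - 1) choose n) * d ^ n\<close>.

  \<^bold>\<open>Double counting.\<close> At a vertex the differences of exponents of minimal monomials, taken over all
  \<open>F i\<close>, span the space. Since every \<open>F i\<close> has at least two minimal monomials there, a basis exchange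
  argument yields at least \<open>k - n + 1\<close> multisets of \<open>n\<close> indices from which one can choose one
  difference each, linearly independent (\<open>many_transversal_choices\<close>). There are
  \<open>(k + n - 1) choose n\<close> multisets, and a given one arises from at most \<open>d ^ n\<close> points. This last
  statement is a tropical Bezout theorem for \<open>n\<close> polynomials (\<open>tropical_Bezout\<close>).

  \<^bold>\<open>Bezout.\<close> The minimal monomials at the points \<open>x\<close> span the cells of a regular subdivision of the Newton
  polytope, so volumes add up over the \<open>x\<close> (\<open>hull_volume_tiling\<close>). This holds for the product of
  any subset of the \<open>n\<close> polynomials, hence also for the alternating sum over all subsets, which is the
  mixed volume. The Newton polytopes are full simplices, because all monomials of admissible degree
  occur, and the total mixed volume is the product of the degrees. Every point contributes a
  nonnegative amount, and at least \<open>1\<close> if an independent choice exists there (\<open>mixed_volume_nonneg\<close>,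
  \<open>mixed_volume_ge_1\<close>). To see this, the cell at the point is subdivided once more by a
  generic lift. Then the only pieces of nonzero mixed volume are parallelepipeds, and these have volume
  at least \<open>1\<close> since their edges are independent integer vectors.
\<close>

section \<open>Ranks of abelian groups\<close>

text \<open>
  Independence of a family rather than of a set: under a homomorphism, distinct elements may acquire
  equal images, and the family then counts as dependent.
\<close>

definition int_indep_family :: "('a, 'b) monoid_scheme \<Rightarrow> 'i set \<Rightarrow> ('i \<Rightarrow> 'a) \<Rightarrow> bool" where
  "int_indep_family G I v \<longleftrightarrow> v ` I \<subseteq> carrier G \<and>
     (\<forall>c :: 'i \<Rightarrow> int. finprod G (\<lambda>i. v i [^]\<^bsub>G\<^esub> c i) I = \<one>\<^bsub>G\<^esub> \<longrightarrow> (\<forall>i\<in>I. c i = 0))"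

lemma int_indep_family_card_le_rank:
  assumes "comm_group G" "finite I" "int_indep_family G I v"
  shows "enat (card I) \<le> abelian_rank G"
proof -
  interpret comm_group G by fact
  have vI: "v \<in> I \<rightarrow> carrier G" using assms(3) by (auto simp: int_indep_family_def)
  have inj: "inj_on v I"
  proof (rule inj_onI, rule ccontr)
    fix i j assume ij: "i \<in> I" "j \<in> I" "v i = v j" "i \<noteq> j"
    define c where "c = (\<lambda>x. if x = i then 1 else if x = j then -1 else (0::int))"
    have "finprod G (\<lambda>x. v x [^]\<^bsub>G\<^esub> c x) I = finprod G (\<lambda>x. v x [^]\<^bsub>G\<^esub> c x) {i,j}"
      using ij vI by (intro finprod_mono_neutral_cong_right) (auto simp: c_def assms(2) Pi_iff)
    also have "\<dots> = \<one>\<^bsub>G\<^esub>"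
      using ij vI by (subst finprod_insert) (auto simp: c_def Pi_iff int_pow_neg)
    finally have "c i = 0" using assms(3) ij unfolding int_indep_family_def by blast
    then show False by (simp add: c_def)
  qed
  have "int_independent G (v ` I)"
    unfolding int_independent_def
  proof (intro conjI allI impI)
    show "v ` I \<subseteq> carrier G" using vI by auto
    fix c assume "finprod G (\<lambda>b. b [^]\<^bsub>G\<^esub> (c b::int)) (v ` I) = \<one>\<^bsub>G\<^esub>"
    then have "finprod G (\<lambda>i. v i [^]\<^bsub>G\<^esub> c (v i)) I = \<one>\<^bsub>G\<^esub>"
      using inj vI by (subst (asm) finprod_reindex) auto
    then show "\<forall>b\<in>v ` I. c b = 0"
      using assms(3) unfolding int_indep_family_def by (auto dest: spec[of _ "\<lambda>i. c (v i)"])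
  qed
  then show ?thesis
    unfolding abelian_rank_def using assms(2) card_image[OF inj]
    by (intro SUP_upper2[of "v ` I"]) auto
qed

lemma finprod_int_pow_combination:
  assumes "comm_group G" "finite K" "S \<subseteq> carrier G"
  shows "finprod G (\<lambda>b. (finprod G (\<lambda>x. x [^]\<^bsub>G\<^esub> (C b x :: int)) S) [^]\<^bsub>G\<^esub> (m b :: int)) K
       = finprod G (\<lambda>x. x [^]\<^bsub>G\<^esub> (\<Sum>b\<in>K. m b * C b x)) S"
proof -
  interpret comm_group G by fact
  have pow: "(finprod G (\<lambda>x. x [^]\<^bsub>G\<^esub> (c x :: int)) T) [^]\<^bsub>G\<^esub> (k::int) = finprod G (\<lambda>x. x [^]\<^bsub>G\<^esub> (k * c x)) T"
    if "T \<subseteq> carrier G" for c T k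
    using that
  proof (induction T rule: infinite_finite_induct)
    case (insert x T)
    then have "(\<lambda>x. x [^]\<^bsub>G\<^esub> c x) \<in> T \<rightarrow> carrier G" "(\<lambda>x. x [^]\<^bsub>G\<^esub> (k * c x)) \<in> T \<rightarrow> carrier G" "x \<in> carrier G" by auto
    with insert show ?case
      by (simp add: int_pow_distrib int_pow_pow mult.commute)
  qed auto
  have S: "\<And>c. (\<lambda>x. x [^]\<^bsub>G\<^esub> (c x::int)) \<in> S \<rightarrow> carrier G" using assms(3) by auto
  show ?thesis
    using assms(2)
  proof (induction K rule: finite_induct)
    case empty
    have "finprod G (\<lambda>x. x [^]\<^bsub>G\<^esub> (0::int)) S = \<one>\<^bsub>G\<^esub>" by (intro finprod_one_eqI) auto
    then show ?case by simp
  next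
    case (insert b K)
    have "finprod G (\<lambda>b. (finprod G (\<lambda>x. x [^]\<^bsub>G\<^esub> C b x) S) [^]\<^bsub>G\<^esub> m b) (insert b K)
      = finprod G (\<lambda>x. x [^]\<^bsub>G\<^esub> (m b * C b x)) S \<otimes>\<^bsub>G\<^esub> finprod G (\<lambda>x. x [^]\<^bsub>G\<^esub> (\<Sum>b\<in>K. m b * C b x)) S"
      using insert S by (subst finprod_insert) (auto simp: pow[OF assms(3)])
    also have "\<dots> = finprod G (\<lambda>x. x [^]\<^bsub>G\<^esub> (m b * C b x) \<otimes>\<^bsub>G\<^esub> x [^]\<^bsub>G\<^esub> (\<Sum>b\<in>K. m b * C b x)) S"
      using S by (simp add: finprod_multf)
    also have "\<dots> = finprod G (\<lambda>x. x [^]\<^bsub>G\<^esub> (\<Sum>b\<in>insert b K. m b * C b x)) S"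
      using insert assms(3) by (intro finprod_cong') (auto simp: int_pow_mult)
    finally show ?case .
  qed
qed

lemma hom_finprod_int_pow:
  assumes "comm_group G" "comm_group H" "f \<in> hom G H" "v ` I \<subseteq> carrier G"
  shows "f (finprod G (\<lambda>i. v i [^]\<^bsub>G\<^esub> (c i :: int)) I) = finprod H (\<lambda>i. f (v i) [^]\<^bsub>H\<^esub> c i) I"
proof -
  interpret G: comm_group G by fact
  interpret H: comm_group H by fact
  interpret group_hom G H f using assms(3) by unfold_locales
  show ?thesis
    using assms(4)
  proof (induction I rule: infinite_finite_induct)
    case (insert i I)
    then have "(\<lambda>i. v i [^]\<^bsub>G\<^esub> c i) \<in> I \<rightarrow> carrier G" "(\<lambda>i. f (v i) [^]\<^bsub>H\<^esub> c i) \<in> I \<rightarrow> carrier H"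
      "v i \<in> carrier G" by auto
    with insert show ?case by (simp add: hom_int_pow)
  qed auto
qed

text \<open>
  Choose a maximal part \<open>T\<close> of an independent set \<open>S\<close> of \<open>B\<close> that stays independent in \<open>C\<close>. By
  maximality each \<open>b \<in> S - T\<close> has a nonzero multiple that lies in the image of \<open>A\<close> modulo the span
  of \<open>T\<close>. Preimages of these elements are independent in \<open>A\<close>, since the matrix of their coefficients is
  diagonal on \<open>S - T\<close>.
\<close>

lemma abelian_rank_exact:
  assumes A: "comm_group A" and B: "comm_group B" and C: "comm_group C"
    and f: "f \<in> hom A B" and g: "g \<in> hom B C" and ker: "kernel B C g = f ` carrier A"
  shows "abelian_rank B \<le> abelian_rank A + abelian_rank C"
  unfolding abelian_rank_def[of B]
proof (rule SUP_least, clarify)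
  fix S assume fin: "finite S" and ind: "int_independent B S"
  interpret A: comm_group A by fact
  interpret B: comm_group B by fact
  interpret C: comm_group C by fact
  interpret f: group_hom A B f using f by unfold_locales
  interpret g: group_hom B C g using g by unfold_locales
  have SB: "S \<subseteq> carrier B" using ind by (auto simp: int_independent_def)
  define TT where "TT = {T. T \<subseteq> S \<and> int_indep_family C T g}"
  have "{} \<in> TT" by (simp add: TT_def int_indep_family_def)
  moreover have "finite TT" using fin by (simp add: TT_def)
  ultimately obtain T where T: "T \<in> TT" and Tmax: "\<And>T'. T' \<in> TT \<Longrightarrow> T \<subseteq> T' \<Longrightarrow> T = T'"
    using finite_has_maximal[of TT] by blast
  have TS: "T \<subseteq> S" and indT: "int_indep_family C T g" using T by (auto simp: TT_def)
  have finT: "finite T" using TS fin finite_subset by blast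
  have "\<exists>c. (\<forall>x. x \<notin> insert b T \<longrightarrow> c x = 0) \<and> c b \<noteq> 0 \<and>
       finprod B (\<lambda>x. x [^]\<^bsub>B\<^esub> (c x::int)) S \<in> kernel B C g" if b: "b \<in> S - T" for b
  proof -
    have "insert b T \<notin> TT" using Tmax[of "insert b T"] b by blast
    then have "\<not> int_indep_family C (insert b T) g" using b TS by (simp add: TT_def)
    moreover have "g ` insert b T \<subseteq> carrier C" using b TS SB by auto
    ultimately obtain c where c: "finprod C (\<lambda>i. g i [^]\<^bsub>C\<^esub> (c i::int)) (insert b T) = \<one>\<^bsub>C\<^esub>"
      "\<exists>i\<in>insert b T. c i \<noteq> 0" unfolding int_indep_family_def by blast
    have "c b \<noteq> 0"
    proof
      assume 0: "c b = 0"
      have "(\<lambda>i. g i [^]\<^bsub>C\<^esub> (c i::int)) \<in> T \<rightarrow> carrier C" using TS SB by auto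
      then have "finprod C (\<lambda>i. g i [^]\<^bsub>C\<^esub> c i) T = \<one>\<^bsub>C\<^esub>"
        using c(1) 0 b finT SB by simp
      then have "\<forall>i\<in>T. c i = 0" using indT unfolding int_indep_family_def by blast
      with 0 c(2) show False by auto
    qed
    define c' where "c' = (\<lambda>x. if x \<in> insert b T then c x else 0)"
    have "g (finprod B (\<lambda>x. x [^]\<^bsub>B\<^esub> c' x) S) = finprod C (\<lambda>x. g x [^]\<^bsub>C\<^esub> c' x) S"
      using hom_finprod_int_pow[OF B C g, of id S] SB by simp
    also have "\<dots> = finprod C (\<lambda>x. g x [^]\<^bsub>C\<^esub> c x) (insert b T)"
      using fin b TS SB by (intro C.finprod_mono_neutral_cong_right) (auto simp: c'_def)
    finally have "g (finprod B (\<lambda>x. x [^]\<^bsub>B\<^esub> c' x) S) = \<one>\<^bsub>C\<^esub>" using c(1) by simp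
    moreover have "finprod B (\<lambda>x. x [^]\<^bsub>B\<^esub> c' x) S \<in> carrier B" using SB by (intro B.finprod_closed) auto
    ultimately show ?thesis using \<open>c b \<noteq> 0\<close>
      by (intro exI[of _ c']) (auto simp: c'_def kernel_def)
  qed
  then have "\<forall>b\<in>S - T. \<exists>c. (\<forall>x. x \<notin> insert b T \<longrightarrow> c x = 0) \<and> c b \<noteq> 0 \<and>
       finprod B (\<lambda>x. x [^]\<^bsub>B\<^esub> (c x::int)) S \<in> f ` carrier A" unfolding ker by blast
  from bchoice[OF this] obtain c where c: "\<And>b. b \<in> S - T \<Longrightarrow> (\<forall>x. x \<notin> insert b T \<longrightarrow> c b x = (0::int)) \<and> c b b \<noteq> 0 \<and>
       finprod B (\<lambda>x. x [^]\<^bsub>B\<^esub> (c b x)) S \<in> f ` carrier A" by blast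
  then have "\<forall>b\<in>S-T. \<exists>a. a \<in> carrier A \<and> f a = finprod B (\<lambda>x. x [^]\<^bsub>B\<^esub> (c b x)) S"
    by (fastforce simp: image_iff)
  from bchoice[OF this] obtain a
    where a: "\<And>b. b \<in> S-T \<Longrightarrow> a b \<in> carrier A \<and> f (a b) = finprod B (\<lambda>x. x [^]\<^bsub>B\<^esub> (c b x)) S"
    by blast
  have "int_indep_family A (S - T) a"
    unfolding int_indep_family_def
  proof (intro conjI allI impI ballI)
    show "a ` (S - T) \<subseteq> carrier A" using a by auto
    fix m :: "'c \<Rightarrow> int" and y assume m: "finprod A (\<lambda>i. a i [^]\<^bsub>A\<^esub> m i) (S - T) = \<one>\<^bsub>A\<^esub>" and y: "y \<in> S - T"
    have "\<one>\<^bsub>B\<^esub> = f (finprod A (\<lambda>i. a i [^]\<^bsub>A\<^esub> m i) (S - T))" using m by simp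
    also have "\<dots> = finprod B (\<lambda>b. f (a b) [^]\<^bsub>B\<^esub> m b) (S - T)"
      using a by (intro hom_finprod_int_pow[OF A B f]) auto
    also have "\<dots> = finprod B (\<lambda>b. (finprod B (\<lambda>x. x [^]\<^bsub>B\<^esub> (c b x)) S) [^]\<^bsub>B\<^esub> m b) (S - T)"
      using a SB by (intro B.finprod_cong') (auto intro!: B.finprod_closed B.int_pow_closed)
    also have "\<dots> = finprod B (\<lambda>x. x [^]\<^bsub>B\<^esub> (\<Sum>b\<in>S-T. m b * c b x)) S"
      using fin SB by (intro finprod_int_pow_combination[OF B]) auto
    finally have one: "finprod B (\<lambda>x. x [^]\<^bsub>B\<^esub> (\<Sum>b\<in>S-T. m b * c b x)) S = \<one>\<^bsub>B\<^esub>" by simp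
    have "\<forall>x\<in>S. (\<Sum>b\<in>S-T. m b * c b x) = 0"
      using ind[unfolded int_independent_def, THEN conjunct2, rule_format, OF one] by blast
    then have "(\<Sum>b\<in>S-T. m b * c b y) = 0" using y by blast
    moreover have "(\<Sum>b\<in>S-T. m b * c b y) = (\<Sum>b\<in>{y}. m b * c b y)"
      using fin y c by (intro sum.mono_neutral_right) auto
    ultimately show "m y = 0" using c[OF y] by simp
  qed
  then have "enat (card (S - T)) \<le> abelian_rank A" using fin by (intro int_indep_family_card_le_rank[OF A]) auto
  moreover have "enat (card T) \<le> abelian_rank C" by (rule int_indep_family_card_le_rank[OF C finT indT])
  moreover have "card S = card (S - T) + card T"
    using fin TS finT by (simp add: card_Diff_subset card_mono)
  ultimately show "enat (card S) \<le> abelian_rank A + abelian_rank C"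
    by (metis add_mono plus_enat_simps(1))
qed

lemma abelian_rank_trivial:
  assumes "trivial_group G" shows "abelian_rank G = 0"
proof -
  have triv: "B = {}" if "int_independent G B" for B
  proof (rule ccontr)
    assume "B \<noteq> {}"
    interpret group G using assms by (simp add: trivial_group_def)
    interpret comm_group G
      using assms by (intro group_comm_groupI) (auto simp: trivial_group_def)
    have B: "B = {\<one>\<^bsub>G\<^esub>}" using that \<open>B \<noteq> {}\<close> assms
      unfolding int_independent_def trivial_group_def by auto
    have "finprod G (\<lambda>b. b [^]\<^bsub>G\<^esub> (1::int)) B = \<one>\<^bsub>G\<^esub>" unfolding B by simp
    then have "(1::int) = 0" using that B unfolding int_independent_def by (auto dest!: spec[of _ "\<lambda>_. 1"])
    then show False by simp
  qed
  then have "abelian_rank G \<le> 0"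
    unfolding abelian_rank_def by (intro SUP_least) (auto simp: zero_enat_def dest!: triv)
  then show ?thesis by simp
qed

lemma abelian_rank_iso_le:
  assumes "comm_group G" "comm_group H" "G \<cong> H"
  shows "abelian_rank G \<le> abelian_rank H"
proof -
  interpret G: comm_group G by fact
  interpret H: comm_group H by fact
  obtain f where f: "f \<in> iso G H" using assms(3) by (auto simp: is_iso_def)
  then have hom: "f \<in> hom G H" and bij: "bij_betw f (carrier G) (carrier H)" by (auto simp: iso_def)
  interpret f: group_hom G H f using hom by unfold_locales
  show ?thesis
    unfolding abelian_rank_def[of G]
  proof (rule SUP_least, clarify)
    fix S assume fin: "finite S" and ind: "int_independent G S"
    have SG: "S \<subseteq> carrier G" using ind by (simp add: int_independent_def)
    have "int_indep_family H S f"
      unfolding int_indep_family_def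
    proof (intro conjI allI impI)
      show "f ` S \<subseteq> carrier H" using SG by auto
      fix c :: "'a \<Rightarrow> int" assume "finprod H (\<lambda>i. f i [^]\<^bsub>H\<^esub> c i) S = \<one>\<^bsub>H\<^esub>"
      then have "f (finprod G (\<lambda>i. i [^]\<^bsub>G\<^esub> c i) S) = f \<one>\<^bsub>G\<^esub>"
        using hom_finprod_int_pow[OF assms(1,2) hom, of id S c] SG by simp
      moreover have "finprod G (\<lambda>i. i [^]\<^bsub>G\<^esub> c i) S \<in> carrier G" using SG by (intro G.finprod_closed) auto
      ultimately have "finprod G (\<lambda>i. i [^]\<^bsub>G\<^esub> c i) S = \<one>\<^bsub>G\<^esub>"
        using bij by (meson G.one_closed bij_betw_def inj_onD)
      then show "\<forall>i\<in>S. c i = 0" using ind by (auto simp: int_independent_def)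
    qed
    then show "enat (card S) \<le> abelian_rank H" using fin by (intro int_indep_family_card_le_rank[OF assms(2)]) auto
  qed
qed

lemma abelian_rank_integer_group: "abelian_rank integer_group \<le> 1"
  unfolding abelian_rank_def
proof (rule SUP_least, clarify)
  fix S :: "int set" assume fin: "finite S" and ind: "int_independent integer_group S"
  interpret comm_group integer_group by (rule abelian_integer_group)
  have "card S \<le> 1"
  proof (rule ccontr)
    assume "\<not> card S \<le> 1"
    then obtain a b where ab: "a \<in> S" "b \<in> S" "a \<noteq> b"
      by (metis card_le_Suc0_iff_eq fin One_nat_def)
    define c where "c = (\<lambda>x. if x = a then b else if x = b then -a else 0)"
    have "finprod integer_group (\<lambda>x. x [^]\<^bsub>integer_group\<^esub> c x) S = finprod integer_group (\<lambda>x. x [^]\<^bsub>integer_group\<^esub> c x) {a,b}"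
      using ab fin by (intro finprod_mono_neutral_cong_right) (auto simp: c_def)
    also have "\<dots> = \<one>\<^bsub>integer_group\<^esub>"
      using ab by (subst finprod_insert) (auto simp: c_def)
    finally have 0: "c a = 0" "c b = 0" using ind ab unfolding int_independent_def by blast+
    then have "a = b" using ab by (auto simp: c_def)
    then show False using ab by simp
  qed
  then show "enat (card S) \<le> 1" by (simp add: one_enat_def)
qed

section \<open>Attaching a convex cell\<close>

text \<open>
  All relative frontiers of bounded convex sets of one dimension are homeomorphic, so it suffices to
  recognise the sphere in a unit ball of a coordinate subspace.
\<close>

lemma rel_frontier_homeomorphic_nsphere:
  fixes S :: "'a::euclidean_space set"
  assumes "convex S" "bounded S" "aff_dim S = int n" "n \<noteq> 0"
  shows "top_of_set (rel_frontier S) homeomorphic_space nsphere (n - 1)"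
proof -
  have "int n \<le> int DIM('a)" using assms(3) aff_dim_le_DIM by metis
  then have "n \<le> card (Basis :: 'a set)" by simp
  then obtain B :: "'a set" where B: "B \<subseteq> Basis" "card B = n" "finite B"
    by (metis obtain_subset_with_card_n)
  have ind: "independent B" using B(1) independent_Basis independent_mono by blast
  have orth: "pairwise orthogonal B"
    using B(1) orthogonal_Basis unfolding pairwise_def by blast
  obtain f :: "(nat \<Rightarrow> real) \<Rightarrow> 'a" and g
    where fg: "homeomorphic_maps (nsphere (n - 1)) (top_of_set (sphere 0 1 \<inter> span B)) f g"
    using homeomorphic_maps_nsphere_euclidean_sphere[OF ind orth B(2) assms(4)] B(1) norm_Basis by blast
  define T where "T = cball 0 1 \<inter> span B"
  have conv: "convex T" "bounded T" by (auto simp: T_def convex_Int subspace_imp_convex bounded_Int)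
  have ne: "interior (cball (0::'a) 1) \<inter> span B \<noteq> {}"
  proof -
    have "0 \<in> interior (cball (0::'a) 1) \<inter> span B" by (simp add: span_zero)
    then show ?thesis by blast
  qed
  have "rel_frontier T = sphere 0 1 \<inter> span B"
    unfolding T_def using ne by (subst convex_affine_rel_frontier_Int) (auto simp: subspace_imp_affine)
  moreover have "aff_dim T = aff_dim S"
  proof -
    have "affine hull T = span B"
      unfolding T_def Int_commute[of "cball 0 1"]
      using ne affine_hull_convex_Int_nonempty_interior[of "span B" "cball 0 1"]
      by (metis Int_commute subspace_span subspace_imp_convex subspace_imp_affine affine_hull_eq)
    then have "aff_dim T = aff_dim (span B)" by (metis aff_dim_affine_hull)
    also have "\<dots> = int (dim B)" by (simp add: aff_dim_subspace)
    also have "\<dots> = int n" using ind B(2) by (simp add: dim_eq_card_independent)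
    finally show ?thesis using assms(3) by simp
  qed
  ultimately have "rel_frontier S homeomorphic sphere 0 1 \<inter> span B"
    using homeomorphic_rel_frontiers_convex_bounded_sets[OF assms(1,2) conv] by metis
  then have "top_of_set (rel_frontier S) homeomorphic_space top_of_set (sphere 0 1 \<inter> span B)"
    by (simp add: homeomorphic_space_iff_homeomorphic)
  moreover have "top_of_set (sphere 0 1 \<inter> span B) homeomorphic_space nsphere (n - 1)"
    using fg homeomorphic_space homeomorphic_space_sym homeomorphic_space_def by blast
  ultimately show ?thesis using homeomorphic_space_trans by blast
qed

text \<open>
  The cell is contractible and the punctured cell retracts to its boundary sphere, so this group is the
  reduced homology of a sphere, one degree lower. A single point is treated separately, as its boundary
  sphere is empty.
\<close>

lemma rank_relative_homology_punctured_convex: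
  fixes S :: "'a::euclidean_space set"
  assumes "compact S" "convex S" "c \<in> rel_interior S"
  shows "abelian_rank (relative_homology_group p (top_of_set S) (S - {c})) \<le> (if p = aff_dim S then 1 else 0)"
proof -
  have cS: "c \<in> S" using assms(3) rel_interior_subset by blast
  define n where "n = nat (aff_dim S)"
  have n: "aff_dim S = int n" using cS aff_dim_empty[of S] aff_dim_geq[of S] by (auto simp: n_def)
  let ?G = "relative_homology_group p (top_of_set S) (S - {c})"
  have "?G \<cong> integer_group \<and> p = aff_dim S \<or> trivial_group ?G"
  proof (cases "n = 0")
    case True
    then have "S = {c}" using n cS by (auto simp: aff_dim_eq_0)
    then have G: "?G = homology_group p (top_of_set {c})" by simp
    show ?thesis
    proof (cases "p = 0")
      case True
      have "path_connected_space (top_of_set {c})" by simp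
      then have "homology_group 0 (top_of_set {c}) \<cong> integer_group"
        by (intro isomorphic_integer_zeroth_homology_group) auto
      then show ?thesis using True n \<open>n = 0\<close> G by simp
    next
      case False
      then show ?thesis using homology_dimension_axiom[of "top_of_set {c}" c p] G by simp
    qed
  next
    case False
    have "S \<noteq> {c}" using n False by auto
    then have ne: "topspace (top_of_set S) \<inter> (S - {c}) \<noteq> {}" using cS by auto
    have "?G \<cong> reduced_homology_group (p - 1) (subtopology (top_of_set S) (S - {c}))"
      using ne assms by (intro isomorphic_group_relative_homology_of_contractible)
        (auto simp: contractible_space_top_of_set convex_imp_contractible)
    also have "subtopology (top_of_set S) (S - {c}) = top_of_set (S - {c})"
      by (simp add: subtopology_subtopology Int_absorb1)
    also have "reduced_homology_group (p - 1) (top_of_set (S - {c})) \<cong> reduced_homology_group (p - 1) (nsphere (n - 1))"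
    proof (rule homotopy_equivalent_space_imp_isomorphic_reduced_homology_groups)
      have "rel_frontier S \<subseteq> S" using assms(1) by (auto simp: rel_frontier_def compact_imp_closed)
      then obtain r where "homotopic_with_canon (\<lambda>x. True) (S - {c}) (S - {c}) id r"
         "retraction (S - {c}) (rel_frontier S) r"
        using rel_frontier_deformation_retract_of_punctured_convex[OF assms(2,2) compact_imp_bounded[OF assms(1)] assms(3)] hull_subset
        by metis
      then have "(S - {c}) homotopy_eqv rel_frontier S" by (rule deformation_retract_imp_homotopy_eqv)
      moreover have "top_of_set (rel_frontier S) homotopy_equivalent_space nsphere (n - 1)"
        using rel_frontier_homeomorphic_nsphere[OF assms(2) compact_imp_bounded[OF assms(1)] n False]
        by (rule homeomorphic_imp_homotopy_equivalent_space)
      ultimately show "top_of_set (S - {c}) homotopy_equivalent_space nsphere (n - 1)"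
        using homotopy_eqv_trans by blast
    qed
    finally have iso: "?G \<cong> reduced_homology_group (p - 1) (nsphere (n - 1))"
      .
    show ?thesis
    proof (cases "p = int n")
      case True
      then have "p - 1 = int (n - 1)" using False by simp
      then show ?thesis using iso reduced_homology_group_nsphere(1)[of "n - 1"] True n
        by (metis iso_trans)
    next
      case p: False
      then have "p - 1 \<noteq> int (n - 1)" using False by simp
      then have "trivial_group (reduced_homology_group (p - 1) (nsphere (n - 1)))"
        by (rule reduced_homology_group_nsphere(2))
      then show ?thesis using iso isomorphic_group_triviality
        by (metis group_reduced_homology_group group_relative_homology_group)
    qed
  qed
  then show ?thesis
  proof
    assume "?G \<cong> integer_group \<and> p = aff_dim S"
    then show ?thesis
      using abelian_rank_iso_le[of ?G integer_group] abelian_rank_integer_group abelian_integer_group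
      by (auto intro: order_trans)
  next
    assume "trivial_group ?G"
    then show ?thesis by (simp add: abelian_rank_trivial)
  qed
qed

text \<open>
  The last property says that the retraction pushes points away from \<open>c\<close>. With it the straight-line
  homotopy to the identity stays in the punctured cell and fixes the boundary, which allows the
  retraction to be extended by the identity to a space that the cell is attached to.
\<close>

lemma radial_retraction_to_rel_frontier:
  fixes S :: "'a::euclidean_space set"
  assumes "compact S" "convex S" "c \<in> rel_interior S"
  obtains r where "continuous_on (S - {c}) r" "\<And>x. x \<in> S - {c} \<Longrightarrow> r x \<in> rel_frontier S"
    "\<And>x. x \<in> rel_frontier S \<Longrightarrow> r x = x"
    "\<And>x. x \<in> S - {c} \<Longrightarrow> c \<notin> closed_segment x (r x)"
proof -
  \<comment> \<open>The projection to directions is injective on the compact relative frontier, so it has a continuous inverse \<open>v\<close> there; the retraction is \<open>v \<circ> u\<close>.\<close>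
  define u where "u = (\<lambda>x. (x - c) /\<^sub>R norm (x - c))"
  have cS: "c \<in> S" using assms(3) rel_interior_subset by blast
  have cn: "c \<notin> rel_frontier S" using assms(3) by (simp add: rel_frontier_def)
  have fS: "rel_frontier S \<subseteq> S" using assms(1) by (auto simp: rel_frontier_def compact_imp_closed)
  have contu: "continuous_on (- {c}) u" unfolding u_def by (intro continuous_intros) auto
  have comp: "compact (rel_frontier S)" using assms(1) by (simp add: compact_rel_frontier_bounded compact_imp_bounded)
  have inj: "x = y" if xy: "x \<in> rel_frontier S" "y \<in> rel_frontier S" "u x = u y" "norm (x - c) \<le> norm (y - c)" for x y
  proof (rule ccontr)
    assume "x \<noteq> y"
    have nz: "norm (x - c) > 0" "norm (y - c) > 0" using xy cn by auto
    have "x - c = norm (x - c) *\<^sub>R u x" using nz by (simp add: u_def)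
    then have eq: "x - c = (norm (x - c) / norm (y - c)) *\<^sub>R (y - c)"
      using xy(3) by (metis scaleR_scaleR u_def divide_inverse)
    define t where "t = norm (x - c) / norm (y - c)"
    have t: "0 < t" "t \<le> 1" "x - c = t *\<^sub>R (y - c)" using nz xy(4) eq by (auto simp: t_def)
    then have "x = (1 - t) *\<^sub>R c + t *\<^sub>R y" by (simp add: algebra_simps)
    moreover have "t \<noteq> 1" using t(3) \<open>x \<noteq> y\<close> by auto
    ultimately have "x \<in> open_segment c y" using t nz by (auto simp: in_segment)
    then have "x \<in> rel_interior S"
      using rel_interior_closure_convex_segment[OF assms(2,3), of y] xy(2) by (auto simp: rel_frontier_def)
    then show False using xy(1) by (simp add: rel_frontier_def)
  qed
  have "inj_on u (rel_frontier S)"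
    by (rule inj_onI) (metis inj linear)
  moreover have "continuous_on (rel_frontier S) u" using contu cn by (auto intro: continuous_on_subset)
  ultimately obtain v where v: "continuous_on (u ` rel_frontier S) v" "\<And>x. x \<in> rel_frontier S \<Longrightarrow> v (u x) = x"
    using continuous_on_inv[OF _ comp, of u "the_inv_into (rel_frontier S) u"] the_inv_into_f_f by metis
  have ray: "\<exists>y d. d > 0 \<and> y \<in> rel_frontier S \<and> y = c + d *\<^sub>R (x - c) \<and> u y = u x" if x: "x \<in> S - {c}" for x
  proof -
    have "c + (x - c) \<in> affine hull S" using x hull_subset[of S affine] by auto
    then obtain d where d: "0 < d" "c + d *\<^sub>R (x - c) \<in> rel_frontier S"
      using ray_to_rel_frontier[OF compact_imp_bounded[OF assms(1)] assms(3), of "x - c"] x by auto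
    moreover have "u (c + d *\<^sub>R (x - c)) = u x" using d(1) by (simp add: u_def)
    ultimately show ?thesis by blast
  qed
  show thesis
  proof
    show "continuous_on (S - {c}) (v \<circ> u)"
    proof (rule continuous_on_compose)
      show "continuous_on (S - {c}) u" using contu by (auto intro: continuous_on_subset)
      show "continuous_on (u ` (S - {c})) v"
      proof (rule continuous_on_subset[OF v(1)])
        show "u ` (S - {c}) \<subseteq> u ` rel_frontier S"
        proof (rule image_subsetI)
          fix x assume "x \<in> S - {c}"
          then obtain y where "y \<in> rel_frontier S" "u y = u x" using ray[of x] by blast
          then show "u x \<in> u ` rel_frontier S" by (metis imageI)
        qed
      qed
    qed
    show "(v \<circ> u) x \<in> rel_frontier S" if "x \<in> S - {c}" for x
      using ray[OF that] v(2) by force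
    show "(v \<circ> u) x = x" if "x \<in> rel_frontier S" for x using v(2)[OF that] by simp
    show "c \<notin> closed_segment x ((v \<circ> u) x)" if x: "x \<in> S - {c}" for x
    proof
      assume c: "c \<in> closed_segment x ((v \<circ> u) x)"
      obtain y d where y: "d > 0" "y \<in> rel_frontier S" "y = c + d *\<^sub>R (x - c)" "u y = u x" using ray[OF x] by blast
      have "(v \<circ> u) x = c + d *\<^sub>R (x - c)" using v(2)[OF y(2)] y by simp
      then obtain t where t: "0 \<le> t" "t \<le> 1" "c = (1 - t) *\<^sub>R x + t *\<^sub>R (c + d *\<^sub>R (x - c))"
        using c by (auto simp: in_segment)
      have "((1 - t) + t * d) *\<^sub>R (x - c) = (1 - t) *\<^sub>R x + t *\<^sub>R (c + d *\<^sub>R (x - c)) - c"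
        by (simp add: algebra_simps)
      also have "\<dots> = 0" using t(3) by simp
      finally have "(1 - t) + t * d = 0" using x by simp
      moreover have "(1 - t) + t * d > 0" using t y(1)
        by (cases "t = 0") (auto intro: add_nonneg_pos)
      ultimately show False by simp
    qed
  qed
qed

text \<open>
  Pushing the punctured cell radially to its boundary, and fixing everything else, is a deformation
  retraction of the punctured union.
\<close>

lemma homology_attach_cell_punctured:
  fixes S :: "'a::euclidean_space set"
  assumes S: "compact S" "convex S" "c \<in> rel_interior S" and X: "closed X" "X \<inter> S = rel_frontier S"
  shows "homology_group p (top_of_set (X \<union> S - {c})) \<cong> homology_group p (top_of_set X)"
proof -
  have cn: "c \<notin> rel_frontier S" using S(3) by (simp add: rel_frontier_def)
  have cS: "c \<in> S" using S(3) rel_interior_subset by blast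
  then have cX: "c \<notin> X" using X cn by auto
  obtain r where r: "continuous_on (S - {c}) r" "\<And>x. x \<in> S - {c} \<Longrightarrow> r x \<in> rel_frontier S"
    "\<And>x. x \<in> rel_frontier S \<Longrightarrow> r x = x" "\<And>x. x \<in> S - {c} \<Longrightarrow> c \<notin> closed_segment x (r x)"
    using radial_retraction_to_rel_frontier[OF S] by metis
  define Y where "Y = X \<union> S - {c}"
  have Y: "Y = (S - {c}) \<union> X" using cX by (auto simp: Y_def)
  \<comment> \<open>Straight-line homotopy inside the cell and constant outside; both agree on the relative frontier.\<close>
  define h where "h = (\<lambda>z::real \<times> 'a. if snd z \<in> S then (1 - fst z) *\<^sub>R snd z + fst z *\<^sub>R r (snd z) else snd z)"
  have conth: "continuous_on ({0..1} \<times> Y) h"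
  proof -
    have Yt: "{0..1} \<times> Y = ({0..1::real} \<times> (S - {c})) \<union> ({0..1} \<times> X)" unfolding Y by auto
    have 1: "{0..1::real} \<times> (S - {c}) = ({0..1} \<times> Y) \<inter> (UNIV \<times> S)" and
      2: "{0..1::real} \<times> X = ({0..1} \<times> Y) \<inter> (UNIV \<times> X)" using cX by (auto simp: Y_def)
    show ?thesis
      unfolding Yt h_def
    proof (rule continuous_on_cases_local)
      show "closedin (top_of_set ({0..1::real} \<times> (S - {c}) \<union> {0..1} \<times> X)) ({0..1} \<times> (S - {c}))"
        unfolding Yt[symmetric] using S(1) by (subst 1) (auto intro!: closedin_closed_Int closed_Times simp: compact_imp_closed)
      show "closedin (top_of_set ({0..1::real} \<times> (S - {c}) \<union> {0..1} \<times> X)) ({0..1} \<times> X)"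
        unfolding Yt[symmetric] using X(1) by (subst 2) (auto intro!: closedin_closed_Int closed_Times)
      show "continuous_on ({0..1} \<times> (S - {c})) (\<lambda>x. (1 - fst x) *\<^sub>R snd x + fst x *\<^sub>R r (snd x))"
        by (intro continuous_intros continuous_on_compose2[OF r(1)]) auto
      show "continuous_on ({0..1} \<times> X) snd" by (intro continuous_intros)
      fix x :: "real \<times> 'a"
      assume "x \<in> {0..1} \<times> (S - {c}) \<and> snd x \<notin> S \<or> x \<in> {0..1} \<times> X \<and> snd x \<in> S"
      then have "snd x \<in> rel_frontier S" using X(2) by (cases x) auto
      then have "r (snd x) = snd x" by (rule r(3))
      then show "(1 - fst x) *\<^sub>R snd x + fst x *\<^sub>R r (snd x) = snd x" by (simp add: algebra_simps)
    qed
  qed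
  have hin: "h (t, x) \<in> Y" if "t \<in> {0..1}" "x \<in> Y" for t x
  proof (cases "x \<in> S")
    case True
    then have x: "x \<in> S - {c}" using that by (auto simp: Y_def)
    have "r x \<in> S" using r(2)[OF x] X(2) by auto
    moreover have "h (t, x) \<in> closed_segment x (r x)" using that True by (auto simp: h_def in_segment)
    ultimately show ?thesis using S(2) x r(4)[OF x] unfolding Y_def
      by (metis Diff_iff UnI2 closed_segment_subset singletonD subsetD)
  qed (use that in \<open>auto simp: h_def\<close>)
  define q where "q = (\<lambda>x. h (1, x))"
  have qc: "continuous_on Y q"
    unfolding q_def by (rule continuous_on_compose2[OF conth]) (auto intro!: continuous_intros)
  have qX: "q x \<in> X" if "x \<in> Y" for x
    using that r(2)[of x] X(2) cX by (auto simp: q_def h_def Y_def)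
  have qid: "q x = x" if "x \<in> X" for x using that r(3)[of x] X(2) by (auto simp: q_def h_def)
  have "homotopic_with_canon (\<lambda>_. True) Y Y id q"
    unfolding homotopic_with_def
  proof (intro exI[of _ h] conjI allI ballI)
    show "continuous_map (prod_topology (top_of_set {0..1}) (top_of_set Y)) (top_of_set Y) h"
      using conth hin by (auto simp: prod_topology_subtopology subtopology_subtopology Sigma_Un_distrib1 Times_Int_Times
          euclidean_product_topology[symmetric] subtopology_Times[symmetric])
  qed (auto simp: h_def q_def)
  then have "homotopic_with (\<lambda>_. True) (top_of_set Y) (top_of_set Y) q id"
    by (simp add: homotopic_with_sym)
  moreover have "retraction_maps (top_of_set Y) (top_of_set X) q id"
    unfolding retraction_maps_def using qc qX qid by (auto simp: Y)
  ultimately show ?thesis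
    unfolding Y_def[symmetric] by (intro deformation_retract_imp_isomorphic_homology_groups) auto
qed

text \<open>
  The exact sequence of the pair of \<open>X \<union> S\<close> and its complement of an inner point \<open>c\<close> of \<open>S\<close>. The
  complement deforms to \<open>X\<close>, and by excision of everything outside \<open>S\<close> the relative group is that of
  the punctured cell.
\<close>

lemma betti_number_attach_cell:
  fixes S :: "'a::euclidean_space set"
  assumes S: "compact S" "convex S" "S \<noteq> {}" and X: "closed X" "X \<inter> S = rel_frontier S"
  shows "betti_number l (X \<union> S) \<le> betti_number l X + (if int l = aff_dim S then 1 else 0)"
proof -
  obtain c where c: "c \<in> rel_interior S" using S rel_interior_eq_empty by blast
  have cS: "c \<in> S" using c rel_interior_subset by blast
  have cX: "c \<notin> X" using X c cS by (auto simp: rel_frontier_def)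
  define Y where "Y = X \<union> S"
  have cY: "c \<in> Y" using cS by (simp add: Y_def)
  have clY: "closed Y" using X S by (auto simp: Y_def compact_imp_closed)
  let ?A = "homology_group (int l) (subtopology (top_of_set Y) (Y - {c}))"
  let ?C = "relative_homology_group (int l) (top_of_set Y) (Y - {c})"
  have "abelian_rank (homology_group (int l) (top_of_set Y)) \<le> abelian_rank ?A + abelian_rank ?C"
    using homology_exactness_axiom_3[of "int l" "top_of_set Y" "Y - {c}"]
    by (intro abelian_rank_exact) (auto simp: abelian_homology_group group_hom_def group_hom_axioms_def)
  also have "?A = homology_group (int l) (top_of_set (X \<union> S - {c}))"
    by (simp add: subtopology_subtopology Y_def Int_absorb1)
  finally have exact: "abelian_rank (homology_group (int l) (top_of_set Y))
     \<le> abelian_rank (homology_group (int l) (top_of_set (X \<union> S - {c}))) + abelian_rank ?C" .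
  have retract: "abelian_rank (homology_group (int l) (top_of_set (X \<union> S - {c}))) \<le> betti_number l X"
    unfolding betti_number_def
    by (intro abelian_rank_iso_le homology_attach_cell_punctured S c X abelian_homology_group)
  have local: "abelian_rank ?C \<le> (if int l = aff_dim S then 1 else 0)"
  proof -
    have "top_of_set Y closure_of (Y - S) \<subseteq> X"
      using X(1) by (intro closure_of_minimal) (auto simp: Y_def closed_subset)
    moreover have "top_of_set Y interior_of (Y - {c}) = Y - {c}"
      by (intro interior_of_openin) (metis openin_delete openin_topspace topspace_euclidean_subtopology)
    ultimately have sub: "top_of_set Y closure_of (Y - S) \<subseteq> top_of_set Y interior_of (Y - {c})"
      using cX by (auto simp: Y_def)
    have "relative_homology_group (int l) (subtopology (top_of_set Y) (Y - (Y - S))) (Y - {c} - (Y - S))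
        \<cong> relative_homology_group (int l) (subtopology (top_of_set Y) Y) (Y - {c})"
      using homology_excision_axiom[OF sub, of Y "int l"] by (auto simp: is_iso_def)
    moreover have "Y - (Y - S) = S" "Y - {c} - (Y - S) = S - {c}" by (auto simp: Y_def)
    ultimately have "relative_homology_group (int l) (top_of_set S) (S - {c}) \<cong> ?C"
      by (simp add: subtopology_subtopology Y_def Int_absorb1)
    then have "abelian_rank ?C \<le> abelian_rank (relative_homology_group (int l) (top_of_set S) (S - {c}))"
      by (intro abelian_rank_iso_le) (auto intro: group.iso_sym)
    also have "\<dots> \<le> (if int l = aff_dim S then 1 else 0)"
      by (rule rank_relative_homology_punctured_convex[OF S(1,2) c])
    finally show ?thesis .
  qed
  show ?thesis
    using order_trans[OF exact add_mono[OF retract local]]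
    by (simp add: betti_number_def Y_def)
qed

section \<open>Polytopal complexes\<close>

text \<open>
  The empty set is a face of every polytope, so it is a cell of every nonempty complex.
\<close>

definition polytopal_complex :: "'a::euclidean_space set set \<Rightarrow> bool" where
  "polytopal_complex \<M> \<longleftrightarrow> finite \<M> \<and> (\<forall>S\<in>\<M>. polytope S) \<and>
     (\<forall>S\<in>\<M>. \<forall>F. F face_of S \<longrightarrow> F \<in> \<M>) \<and> (\<forall>S\<in>\<M>. \<forall>T\<in>\<M>. S \<inter> T face_of S)"

text \<open>
  The relative boundary of a polytope is the union of its proper faces, and every other cell meets \<open>S\<close> in
  a face of \<open>S\<close>, which is proper by maximality.
\<close>

lemma polytopal_complex_remove_maximal:
  assumes "polytopal_complex \<M>" "S \<in> \<M>" "\<And>T. T \<in> \<M> \<Longrightarrow> \<not> S \<subset> T"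
  shows "polytopal_complex (\<M> - {S})" "\<Union>(\<M> - {S}) \<inter> S = rel_frontier S"
proof -
  note M = assms(1)[unfolded polytopal_complex_def]
  show "polytopal_complex (\<M> - {S})"
    unfolding polytopal_complex_def
  proof (intro conjI ballI allI impI)
    fix T F assume T: "T \<in> \<M> - {S}" and F: "F face_of T"
    then have "F \<in> \<M>" using M by blast
    moreover have "F \<noteq> S"
      using T face_of_imp_subset[OF F] assms(3)[of T] by blast
    ultimately show "F \<in> \<M> - {S}" by blast
  qed (use M in auto)
  have poly: "polytope S" using M assms(2) by blast
  show "\<Union>(\<M> - {S}) \<inter> S = rel_frontier S"
  proof (intro equalityI subsetI)
    fix x assume "x \<in> \<Union>(\<M> - {S}) \<inter> S"
    then obtain T where T: "T \<in> \<M>" "T \<noteq> S" "x \<in> T" "x \<in> S" by blast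
    have "S \<inter> T face_of S" using M T assms(2) by blast
    moreover have "S \<inter> T \<noteq> S" using T assms(3)[of T] by blast
    ultimately show "x \<in> rel_frontier S" using T face_of_subset_rel_frontier by blast
  next
    fix x assume "x \<in> rel_frontier S"
    then have "x \<in> \<Union>{F. F face_of S \<and> F \<noteq> S}"
      using rel_frontier_of_polyhedron_alt[OF polytope_imp_polyhedron[OF poly]] by simp
    then show "x \<in> \<Union>(\<M> - {S}) \<inter> S" using M assms(2) face_of_imp_subset by blast
  qed
qed

theorem betti_number_polytopal_complex:
  assumes "polytopal_complex \<M>"
  shows "betti_number l (\<Union>\<M>) \<le> enat (card {S \<in> \<M>. aff_dim S = int l})"
  using assms
proof (induction "card \<M>" arbitrary: \<M> rule: less_induct)
  case less
  note M = less.prems[unfolded polytopal_complex_def]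
  have fin: "finite \<M>" using M by blast
  show ?case
  proof (cases "\<M> \<subseteq> {{}}")
    case True
    then have U: "\<Union>\<M> = {}" by blast
    have "betti_number l (\<Union>\<M>) = 0"
      unfolding betti_number_def U by (intro abelian_rank_trivial trivial_homology_group_empty) simp
    then show ?thesis by simp
  next
    case False
    then obtain S0 where S0: "S0 \<in> \<M>" "S0 \<noteq> {}" by blast
    obtain S where S: "S \<in> \<M>" "S0 \<subseteq> S" and max: "\<And>T. T \<in> \<M> \<Longrightarrow> S \<subseteq> T \<Longrightarrow> S = T"
      using finite_has_maximal2[OF fin S0(1)] by blast
    have max': "\<And>T. T \<in> \<M> \<Longrightarrow> \<not> S \<subset> T" using max by blast
    note rem = polytopal_complex_remove_maximal[OF less.prems S(1) max']
    have poly: "polytope S" using M S by blast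
    define d where "d = (if int l = aff_dim S then 1 else (0::nat))"
    have "card (\<M> - {S}) < card \<M>" using fin S by (meson card_Diff1_less)
    then have IH: "betti_number l (\<Union>(\<M> - {S})) \<le> enat (card {T \<in> \<M> - {S}. aff_dim T = int l})"
      using rem(1) by (rule less.hyps)
    have "\<Union>\<M> = \<Union>(\<M> - {S}) \<union> S" using S by blast
    moreover have "S \<noteq> {}" using S0 S by blast
    moreover have "closed (\<Union>(\<M> - {S}))" using M fin by (intro closed_Union) (auto intro: polytope_imp_closed)
    ultimately have "betti_number l (\<Union>\<M>) \<le> betti_number l (\<Union>(\<M> - {S})) + (if int l = aff_dim S then 1 else 0)"
      using betti_number_attach_cell[of S "\<Union>(\<M> - {S})" l] rem(2) poly
      by (auto simp: polytope_imp_compact polytope_imp_convex)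
    also have "\<dots> = betti_number l (\<Union>(\<M> - {S})) + enat d" by (simp add: d_def zero_enat_def one_enat_def)
    also have "\<dots> \<le> enat (card {T \<in> \<M> - {S}. aff_dim T = int l}) + enat d" by (intro add_mono IH) simp
    also have "\<dots> = enat (card {T \<in> \<M>. aff_dim T = int l})"
    proof (cases "int l = aff_dim S")
      case True
      then have "{T \<in> \<M>. aff_dim T = int l} = insert S {T \<in> \<M> - {S}. aff_dim T = int l}" using S by auto
      then show ?thesis using fin True by (simp add: d_def)
    next
      case False
      then have "{T \<in> \<M>. aff_dim T = int l} = {T \<in> \<M> - {S}. aff_dim T = int l}" by auto
      then show ?thesis using False by (simp add: d_def)
    qed
    finally show ?thesis .
  qed
qed

text \<open>
  Two cells of dimension \<open>l\<close> that share \<open>l + 1\<close> affinely independent vertices meet in a face of full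
  dimension of each, so they coincide.
\<close>

lemma card_faces_le_vertices_power:
  assumes "polytopal_complex \<M>"
  shows "card {S \<in> \<M>. aff_dim S = int l} \<le> card {v. {v} \<in> \<M>} ^ (l + 1)"
proof -
  note M = assms[unfolded polytopal_complex_def]
  have fin: "finite \<M>" using M by blast
  define W where "W = {v. {v} \<in> \<M>}"
  have "finite ((\<lambda>v. {v}) ` W)" by (rule finite_subset[OF _ fin]) (auto simp: W_def)
  then have finW: "finite W" by (rule finite_imageD) (auto intro: inj_onI)
  have "\<exists>B. B \<subseteq> W \<and> B \<subseteq> S \<and> \<not> affine_dependent B \<and> card B = l + 1"
    if S: "S \<in> \<M>" "aff_dim S = int l" for S
  proof -
    have poly: "polytope S" using S M by blast
    define V where "V = {x. x extreme_point_of S}"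
    have hull: "S = convex hull V"
      unfolding V_def using poly by (intro Krein_Milman_Minkowski polytope_imp_compact polytope_imp_convex)
    have dim: "aff_dim V = int l" using S(2) aff_dim_convex_hull[of V, folded hull] by simp
    have VS: "V \<subseteq> S" by (auto simp: V_def extreme_point_of_def)
    have VW: "V \<subseteq> W" using S M by (auto simp: V_def W_def face_of_singleton[symmetric])
    obtain B where B: "\<not> affine_dependent B" "B \<subseteq> V" "affine hull B = affine hull V"
      using affine_basis_exists by metis
    have "int (card B) = aff_dim B + 1" using B(1) aff_dim_affine_independent by fastforce
    also have "aff_dim B = int l" using B(3) dim by (metis aff_dim_affine_hull)
    finally show ?thesis using B VS VW by (intro exI[of _ B]) auto
  qed
  then obtain B where B: "\<And>S. S \<in> \<M> \<Longrightarrow> aff_dim S = int l \<Longrightarrow>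
      B S \<subseteq> W \<and> B S \<subseteq> S \<and> \<not> affine_dependent (B S) \<and> card (B S) = l + 1" by metis
  have eq: "S \<subseteq> T" if ST: "S \<in> \<M>" "aff_dim S = int l" "T \<in> \<M>" "aff_dim T = int l" "B S = B T" for S T
  proof -
    have "int l = aff_dim (B S)" using B[OF ST(1,2)] aff_dim_affine_independent by fastforce
    also have "\<dots> \<le> aff_dim (S \<inter> T)" using B[OF ST(1,2)] B[OF ST(3,4)] ST(5) by (intro aff_dim_subset) auto
    finally have "\<not> aff_dim (S \<inter> T) < aff_dim S" using ST(2) by simp
    moreover have "S \<inter> T face_of S" "convex S" using M ST by (auto intro: polytope_imp_convex)
    ultimately have "S \<inter> T = S" using face_of_aff_dim_lt by blast
    then show ?thesis by blast
  qed
  have "card {S \<in> \<M>. aff_dim S = int l} \<le> card {C. C \<subseteq> W \<and> card C = l + 1}"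
  proof (rule card_inj_on_le)
    show "inj_on B {S \<in> \<M>. aff_dim S = int l}" by (rule inj_onI) (use eq in blast)
    show "B ` {S \<in> \<M>. aff_dim S = int l} \<subseteq> {C. C \<subseteq> W \<and> card C = l + 1}" using B by blast
    show "finite {C. C \<subseteq> W \<and> card C = l + 1}" using finW by auto
  qed
  also have "\<dots> = card W choose (l + 1)" using n_subsets[OF finW] by simp
  also have "\<dots> \<le> card W ^ (l + 1)"
    by (cases "l + 1 \<le> card W") (auto intro: binomial_le_pow simp del: power_Suc simp: binomial_eq_0)
  finally show ?thesis by (simp add: W_def)
qed

section \<open>Regular subdivisions tile the Newton polytope\<close>

text \<open>
  A pair \<open>(q, c)\<close> represents the tropical monomial with exponent \<open>q\<close> and coefficient \<open>c\<close>. The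
  product of tropical polynomials is then the Minkowski sum of sets of pairs.
\<close>

definition affine_value :: "'a::euclidean_space \<Rightarrow> 'a \<times> real \<Rightarrow> real" where
  "affine_value x m = fst m \<bullet> x + snd m"

definition argmins :: "('a::euclidean_space \<times> real) set \<Rightarrow> 'a \<Rightarrow> ('a \<times> real) set" where
  "argmins M x = {m \<in> M. \<forall>m'\<in>M. affine_value x m \<le> affine_value x m'}"

text \<open>
  The hull of these exponents is the cell dual to \<open>x\<close> in the regular subdivision of the Newton polytope
  of \<open>M\<close>.
\<close>

abbreviation dual_cell :: "('a::euclidean_space \<times> real) set \<Rightarrow> 'a \<Rightarrow> 'a set" where
  "dual_cell M x \<equiv> fst ` argmins M x"

abbreviation hull_volume :: "'a::euclidean_space set \<Rightarrow> real" where
  "hull_volume P \<equiv> measure lebesgue (convex hull P)"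

lemma affine_value_add: "affine_value x (m + n) = affine_value x m + affine_value x n"
  by (simp add: affine_value_def algebra_simps)

lemma argmins_subset: "argmins M x \<subseteq> M"
  by (auto simp: argmins_def)

lemma argmins_nonempty: "finite M \<Longrightarrow> M \<noteq> {} \<Longrightarrow> argmins M x \<noteq> {}"
proof -
  assume "finite M" "M \<noteq> {}"
  then have "Min (affine_value x ` M) \<in> affine_value x ` M" by (intro Min_in) auto
  then obtain m where "m \<in> M" "affine_value x m = Min (affine_value x ` M)" by (metis imageE)
  then have "m \<in> argmins M x" using \<open>finite M\<close> by (auto simp: argmins_def)
  then show ?thesis by blast
qed

lemma argmins_eq_iff:
  assumes "m \<in> argmins M x"
  shows "argmins M x = {m' \<in> M. affine_value x m' = affine_value x m}"
  using assms by (auto simp: argmins_def intro: antisym)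

lemma argmins_plus: "argmins (M + N) x = argmins M x + argmins N x"
proof (intro equalityI subsetI)
  fix z assume z: "z \<in> argmins (M + N) x"
  then obtain m n where mn: "z = m + n" "m \<in> M" "n \<in> N" by (auto simp: argmins_def elim: set_plus_elim)
  have "affine_value x m \<le> affine_value x m'" if "m' \<in> M" for m'
    using z mn set_plus_intro[OF that mn(3)] by (force simp: argmins_def affine_value_add)
  moreover have "affine_value x n \<le> affine_value x n'" if "n' \<in> N" for n'
    using z mn set_plus_intro[OF mn(2) that] by (force simp: argmins_def affine_value_add)
  ultimately show "z \<in> argmins M x + argmins N x" using mn by (auto simp: argmins_def)
next
  fix z assume "z \<in> argmins M x + argmins N x"
  then show "z \<in> argmins (M + N) x"
    by (elim set_plus_elim)
      (auto simp only: argmins_def affine_value_add mem_Collect_eq elim!: set_plus_elim intro!: add_mono set_plus_intro)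
qed

lemma argmins_sum: "argmins (\<Sum>i\<in>S. M i) x = (\<Sum>i\<in>S. argmins (M i) x)"
proof -
  have "argmins 0 x = 0" by (auto simp: argmins_def)
  then show ?thesis by (induction S rule: infinite_finite_induct) (simp_all add: argmins_plus del: set_zero)
qed

lemma fst_image_set_plus: "fst ` (M + N) = fst ` M + fst ` N"
  by (force simp: set_plus_def image_iff)

lemma fst_image_set_sum: "fst ` (\<Sum>i\<in>S. M i) = (\<Sum>i\<in>S. fst ` M i)"
  by (induction S rule: infinite_finite_induct) (auto simp: fst_image_set_plus)

lemma dual_cell_sum: "dual_cell (\<Sum>i\<in>S. M i) x = (\<Sum>i\<in>S. dual_cell (M i) x)"
  by (simp add: argmins_sum fst_image_set_sum)

lemma convex_hull_inner_le:
  fixes P :: "'a::euclidean_space set"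
  assumes "p \<in> convex hull P" "\<And>q. q \<in> P \<Longrightarrow> b \<le> q \<bullet> y"
  shows "b \<le> p \<bullet> y"
proof -
  have "convex hull P \<subseteq> {q. b \<le> y \<bullet> q}"
    using assms(2) by (intro hull_minimal convex_halfspace_ge) (auto simp: inner_commute)
  then show ?thesis using assms(1) by (auto simp: inner_commute)
qed

text \<open>
  The minimum of the monomials is a concave function of the point, and the hull of a dual cell is its
  superdifferential there. A common supergradient at \<open>x\<close> and \<open>y\<close> determines the difference of the two
  values, which is one linear equation on it.
\<close>

lemma dual_cells_inter_negligible:
  fixes x y :: "'a::euclidean_space"
  assumes "finite M" "x \<noteq> y"
  shows "negligible (convex hull (dual_cell M x) \<inter> convex hull (dual_cell M y))"
proof (cases "M = {}")
  case False
  define H where "H = (\<lambda>x. Min (affine_value x ` M))"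
  have H: "H z \<le> affine_value z m" if "m \<in> M" for z m using assms(1) that by (simp add: H_def)
  have H': "affine_value z m = H z" if "m \<in> argmins M z" for z m
    using assms(1) that by (auto simp: H_def argmins_def intro!: Min_eqI[symmetric])
  have le: "H v - H u \<le> p \<bullet> (v - u)" if "p \<in> convex hull (dual_cell M u)" for p u v
  proof (rule convex_hull_inner_le[OF that])
    fix q assume "q \<in> dual_cell M u"
    then obtain m where m: "m \<in> argmins M u" "q = fst m" by blast
    then show "H v - H u \<le> q \<bullet> (v - u)"
      using H'[OF m(1)] H[of m v] by (auto simp: argmins_def affine_value_def algebra_simps)
  qed
  have "convex hull (dual_cell M x) \<inter> convex hull (dual_cell M y) \<subseteq> {p. (y - x) \<bullet> p = H y - H x}"
  proof clarify
    fix p assume "p \<in> convex hull (dual_cell M x)" "p \<in> convex hull (dual_cell M y)"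
    from le[OF this(1), of y] le[OF this(2), of x]
    show "(y - x) \<bullet> p = H y - H x" by (simp add: algebra_simps inner_commute)
  qed
  moreover have "negligible {p. (y - x) \<bullet> p = H y - H x}" using assms(2) by (intro negligible_hyperplane) auto
  ultimately show ?thesis using negligible_subset by blast
qed (simp add: argmins_def)

lemma finite_fat_dual_cells:
  fixes M :: "('a::euclidean_space \<times> real) set"
  assumes "finite M"
  shows "finite {x. \<not> negligible (convex hull (dual_cell M x))}"
proof (rule inj_on_finite[where f = "argmins M" and B = "Pow M"])
  show "inj_on (argmins M) {x. \<not> negligible (convex hull (dual_cell M x))}"
  proof (rule inj_onI, rule ccontr)
    fix x y assume "x \<in> {x. \<not> negligible (convex hull (dual_cell M x))}" "argmins M x = argmins M y" "x \<noteq> y"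
    then show False using dual_cells_inter_negligible[OF assms, of x y] by simp
  qed
qed (use assms in \<open>auto simp: argmins_def\<close>)

text \<open>
  For \<open>p\<close> in the interior, the minimum of the monomials minus \<open>p \<bullet> y\<close> tends to minus infinity
  at least linearly in the norm of \<open>y\<close>, so it has a maximum point \<open>x\<close>. If \<open>p\<close> were outside the hull of the dual cell at \<open>x\<close>,
  a separating direction would lead to larger values.
\<close>

lemma interior_hull_subset_dual_cells:
  fixes M :: "('a::euclidean_space \<times> real) set"
  assumes "finite M" "p \<in> interior (convex hull (fst ` M))"
  shows "\<exists>x. p \<in> convex hull (dual_cell M x)"
proof -
  have ne: "M \<noteq> {}" using assms(2) by auto
  define g where "g = (\<lambda>y. Min ((\<lambda>m. affine_value y m - p \<bullet> y) ` M))"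
  have gle: "g y \<le> affine_value y m - p \<bullet> y" if "m \<in> M" for y m using that assms(1) by (auto simp: g_def)
  have gin: "\<exists>m\<in>M. g y = affine_value y m - p \<bullet> y" for y
  proof -
    have "g y \<in> (\<lambda>m. affine_value y m - p \<bullet> y) ` M" unfolding g_def using assms(1) ne by (intro Min_in) auto
    then show ?thesis by auto
  qed
  have contg: "continuous_on UNIV g"
  proof -
    have *: "continuous_on UNIV (\<lambda>y. Min ((\<lambda>m. affine_value y m - p \<bullet> y) ` N))" if "finite N" "N \<noteq> {}" for N
      using that
    proof (induction rule: finite_ne_induct)
      case (singleton m)
      show ?case by (simp add: affine_value_def) (intro continuous_intros)
    next
      case (insert m N)
      have eq: "(\<lambda>y. Min ((\<lambda>m. affine_value y m - p \<bullet> y) ` insert m N))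
        = (\<lambda>y. min (affine_value y m - p \<bullet> y) (Min ((\<lambda>m. affine_value y m - p \<bullet> y) ` N)))"
        using insert by simp
      have "continuous_on UNIV (\<lambda>y. min (affine_value y m - p \<bullet> y) (Min ((\<lambda>m. affine_value y m - p \<bullet> y) ` N)))"
        unfolding affine_value_def by (intro continuous_intros insert.IH[unfolded affine_value_def])
      then show ?case unfolding eq .
    qed
    show ?thesis unfolding g_def by (rule *[OF assms(1) ne])
  qed
  obtain e where e: "e > 0" "cball p e \<subseteq> convex hull (fst ` M)"
    using assms(2) mem_interior_cball by blast
  define C where "C = Max (snd ` M)"
  have gdecay: "g y \<le> C - e * norm y" for y
  proof (cases "y = 0")
    case True
    obtain m where "m \<in> M" using ne by blast
    then have "g y \<le> snd m" using gle[of m y] True by (simp add: affine_value_def)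
    also have "\<dots> \<le> C" using assms(1) \<open>m \<in> M\<close> by (auto simp: C_def)
    finally show ?thesis using True by simp
  next
    case False
    \<comment> \<open>A point of the Newton polytope whose inner product with \<open>y\<close> is smaller than that of \<open>p\<close> by \<open>e * norm y\<close>.\<close>
    define q where "q = p - (e / norm y) *\<^sub>R y"
    have "q \<in> cball p e" using e(1) False by (simp add: q_def dist_norm)
    then have q: "q \<in> convex hull (fst ` M)" using e by blast
    have "\<exists>m\<in>M. fst m \<bullet> y \<le> q \<bullet> y"
    proof (rule ccontr)
      assume no: "\<not> ?thesis"
      define b where "b = Min ((\<lambda>m. fst m \<bullet> y) ` M)"
      have "b \<in> (\<lambda>m. fst m \<bullet> y) ` M" unfolding b_def using assms(1) ne by (intro Min_in) auto
      then have "q \<bullet> y < b" using no by force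
      moreover have "b \<le> q \<bullet> y"
      proof (rule convex_hull_inner_le[OF q])
        fix z assume "z \<in> fst ` M"
        then have "z \<bullet> y \<in> (\<lambda>m. fst m \<bullet> y) ` M" by blast
        then show "b \<le> z \<bullet> y" unfolding b_def using assms(1) by (intro Min_le) auto
      qed
      ultimately show False by simp
    qed
    then obtain m where m: "m \<in> M" "fst m \<bullet> y \<le> q \<bullet> y" by blast
    have "q \<bullet> y = p \<bullet> y - e * norm y"
    proof -
      have "y \<bullet> y = norm y * norm y" by (simp add: dot_square_norm power2_eq_square)
      then show ?thesis using False by (simp add: q_def inner_diff_left)
    qed
    moreover have "snd m \<le> C" using assms(1) m by (auto simp: C_def)
    ultimately show ?thesis using gle[OF m(1), of y] m(2) by (simp add: affine_value_def)
  qed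
  \<comment> \<open>Beyond radius \<open>R\<close> the values are below \<open>g 0\<close>.\<close>
  define R where "R = max 0 ((C - g 0) / e)"
  have "\<exists>x\<in>cball 0 R. \<forall>y\<in>cball 0 R. g y \<le> g x"
    by (intro continuous_attains_sup continuous_on_subset[OF contg]) (auto simp: R_def)
  then obtain x where x: "\<And>y. y \<in> cball 0 R \<Longrightarrow> g y \<le> g x" by blast
  have max: "g y \<le> g x" for y
  proof (cases "y \<in> cball 0 R")
    case False
    then have "(C - g 0) / e < norm y" by (auto simp: R_def)
    then have "C - e * norm y < g 0" using e(1) by (simp add: divide_less_eq mult.commute)
    then have "g y < g 0" using gdecay[of y] by simp
    also have "\<dots> \<le> g x" by (rule x) (auto simp: R_def)
    finally show ?thesis by simp
  qed (rule x)
  have "p \<in> convex hull (dual_cell M x)"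
  proof (rule ccontr)
    assume p: "p \<notin> convex hull (dual_cell M x)"
    have "finite (dual_cell M x)" using assms(1) by (auto simp: argmins_def)
    then have "closed (convex hull (dual_cell M x))" by (simp add: compact_imp_closed finite_imp_compact_convex_hull)
    then obtain a b where ab: "a \<bullet> p < b" "\<And>q. q \<in> convex hull (dual_cell M x) \<Longrightarrow> b < a \<bullet> q"
      using separating_hyperplane_closed_point[of "convex hull (dual_cell M x)" p] p convex_convex_hull by metis
    have pos: "0 < a \<bullet> fst m - a \<bullet> p" if "m \<in> argmins M x" for m
      using ab(1) ab(2)[of "fst m"] hull_inc[of "fst m" "dual_cell M x" convex] that by fastforce
    have gx: "g x = affine_value x m - p \<bullet> x" if m: "m \<in> argmins M x" for m
      using gin[of x] gle[of m x] m by (force simp: argmins_def)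
    have "\<forall>\<^sub>F t in at_right 0. g x < affine_value (x + t *\<^sub>R a) m - p \<bullet> (x + t *\<^sub>R a)" if m: "m \<in> M" for m
    proof (cases "m \<in> argmins M x")
      case True
      have "\<forall>\<^sub>F t::real in at_right 0. 0 < t" by (simp add: eventually_at_right_less)
      then show ?thesis
      proof eventually_elim
        case (elim t)
        then have "0 < t * (a \<bullet> fst m - a \<bullet> p)" using pos[OF True] by simp
        then show ?case using gx[OF True] by (simp add: affine_value_def algebra_simps inner_commute)
      qed
    next
      case False
      have lt: "g x < affine_value x m - p \<bullet> x"
      proof -
        obtain m' where "m' \<in> argmins M x" using argmins_nonempty[OF assms(1) ne] by blast
        moreover obtain m'' where "m'' \<in> M" "affine_value x m'' < affine_value x m"
          using False m unfolding argmins_def by (auto simp: not_le)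
        ultimately have "affine_value x m' < affine_value x m" by (fastforce simp: argmins_def)
        then show ?thesis using gx[OF \<open>m' \<in> argmins M x\<close>] by simp
      qed
      have "((\<lambda>t. affine_value (x + t *\<^sub>R a) m - p \<bullet> (x + t *\<^sub>R a)) \<longlongrightarrow> affine_value (x + 0 *\<^sub>R a) m - p \<bullet> (x + 0 *\<^sub>R a)) (at_right 0)"
        unfolding affine_value_def by (intro tendsto_intros)
      then show ?thesis by (rule order_tendstoD(1)) (use lt in simp)
    qed
    then have "\<forall>\<^sub>F t in at_right 0. \<forall>m\<in>M. g x < affine_value (x + t *\<^sub>R a) m - p \<bullet> (x + t *\<^sub>R a)"
      using assms(1) by (simp add: eventually_ball_finite)
    then obtain t where t: "\<forall>m\<in>M. g x < affine_value (x + t *\<^sub>R a) m - p \<bullet> (x + t *\<^sub>R a)"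
      using eventually_happens'[OF trivial_limit_at_right_real] by blast
    obtain m where "m \<in> M" "g (x + t *\<^sub>R a) = affine_value (x + t *\<^sub>R a) m - p \<bullet> (x + t *\<^sub>R a)"
      using gin[of "x + t *\<^sub>R a"] by blast
    then have "g x < g (x + t *\<^sub>R a)" using t by simp
    then show False using max[of "x + t *\<^sub>R a"] by simp
  qed
  then show ?thesis by blast
qed

text \<open>
  Almost every point of the Newton polytope lies in the hull of a dual cell that is not negligible: the
  remaining points are covered by the frontier and by the negligible hulls of sets of exponents, which
  are finite in number.
\<close>

lemma hull_volume_tiling:
  fixes M :: "('a::euclidean_space \<times> real) set"
  assumes M: "finite M" and X: "finite X" "\<And>x. \<not> negligible (convex hull (dual_cell M x)) \<Longrightarrow> x \<in> X"
  shows "hull_volume (fst ` M) = (\<Sum>x\<in>X. hull_volume (dual_cell M x))"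
proof -
  have fin: "finite (dual_cell M x)" for x using M by (auto simp: argmins_def)
  have meas: "convex hull P \<in> lmeasurable" if "finite P" for P :: "'a set"
    using that by (intro lmeasurable_compact finite_imp_compact_convex_hull)
  let ?U = "\<Union>x\<in>X. convex hull (dual_cell M x)"
  have U: "?U \<in> lmeasurable" using X(1) by (intro fmeasurable.finite_UN) (auto intro: meas fin)
  define N where "N = \<Union>{convex hull (fst ` A) | A. A \<subseteq> M \<and> negligible (convex hull (fst ` A))}"
  have "{convex hull (fst ` A) | A. A \<subseteq> M \<and> negligible (convex hull (fst ` A))} \<subseteq> (\<lambda>A. convex hull (fst ` A)) ` Pow M" by auto
  then have "finite {convex hull (fst ` A) | A. A \<subseteq> M \<and> negligible (convex hull (fst ` A))}"
    by (rule finite_subset) (use M in simp)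
  then have N: "negligible N" unfolding N_def by (intro negligible_Union) auto
  have "negligible (N \<union> frontier (convex hull (fst ` M)))"
    using N by (simp add: negligible_convex_frontier)
  moreover have "convex hull (fst ` M) - ?U \<subseteq> N \<union> frontier (convex hull (fst ` M))"
  proof
    fix p assume p: "p \<in> convex hull (fst ` M) - ?U"
    show "p \<in> N \<union> frontier (convex hull (fst ` M))"
    proof (cases "p \<in> interior (convex hull (fst ` M))")
      case True
      then obtain x where x: "p \<in> convex hull (dual_cell M x)" using interior_hull_subset_dual_cells[OF M] by blast
      then have "negligible (convex hull (dual_cell M x))" using p X(2) by blast
      then show ?thesis using x argmins_subset[of M x] unfolding N_def by blast
    next
      case False
      then show ?thesis using p closure_subset by (auto simp: frontier_def)
    qed
  qed
  moreover have sub: "?U \<subseteq> convex hull (fst ` M)"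
    using argmins_subset[of M] by (intro UN_least hull_mono image_mono)
  ultimately have "negligible (sym_diff (convex hull (fst ` M)) ?U)"
    by (metis Diff_eq_empty_iff negligible_subset sup_bot.right_neutral)
  then have "measure lebesgue (convex hull (fst ` M)) = measure lebesgue ?U"
    using measure_negligible_symdiff[OF U] by (metis Un_commute)
  also have "\<dots> = (\<Sum>x\<in>X. hull_volume (dual_cell M x))"
    using dual_cells_inter_negligible[OF M] X(1)
    by (intro measure_negligible_finite_Union_image) (auto simp: pairwise_def intro: meas fin)
  finally show ?thesis .
qed

section \<open>Mixed volumes\<close>

text \<open>
  This is \<open>n!\<close> times the classical mixed volume of the convex hulls, given by its polarization formula.
  As a signed sum of volumes it inherits additivity over subdivisions at once.
\<close>

definition mixed_volume :: "('n \<Rightarrow> (real ^ 'n::finite) set) \<Rightarrow> real" where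
  "mixed_volume P = (\<Sum>S\<in>UNIV. (-1) ^ (CARD('n) - card S) * hull_volume (\<Sum>i\<in>S. P i))"

lemma hull_volume_translate: "hull_volume ({p} + P) = hull_volume P"
proof -
  have "{p} + P = (+) p ` P" by (auto simp: set_plus_def)
  then show ?thesis by (simp add: convex_hull_translation measure_translation)
qed

lemma nonempty_set_sum: "(\<And>i. i \<in> S \<Longrightarrow> P i \<noteq> {}) \<Longrightarrow> (\<Sum>i\<in>S. P i) \<noteq> ({} :: 'a::comm_monoid_add set)"
  by (induction S rule: infinite_finite_induct) (auto simp: set_plus_def)

lemma negligible_hull_sum_mono:
  fixes P :: "'i::finite \<Rightarrow> 'a::euclidean_space set"
  assumes "\<And>i. P i \<noteq> {}" "negligible (convex hull (\<Sum>i\<in>UNIV. P i))"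
  shows "negligible (convex hull (\<Sum>i\<in>S. P i))"
proof -
  obtain b where b: "b \<in> (\<Sum>i\<in>-S. P i)" using nonempty_set_sum[of "-S" P] assms(1) by blast
  have "(\<Sum>i\<in>UNIV. P i) = (\<Sum>i\<in>-S. P i) + (\<Sum>i\<in>S. P i)"
    by (metis Compl_partition2 finite_code sum.union_disjoint Compl_disjoint2)
  then have "(\<lambda>q. b + q) ` (\<Sum>i\<in>S. P i) \<subseteq> (\<Sum>i\<in>UNIV. P i)" using b by auto
  then have "convex hull ((\<lambda>q. b + q) ` (\<Sum>i\<in>S. P i)) \<subseteq> convex hull (\<Sum>i\<in>UNIV. P i)" by (rule hull_mono)
  then have "negligible ((\<lambda>q. b + q) ` (convex hull (\<Sum>i\<in>S. P i)))"
    using assms(2) negligible_subset by (metis convex_hull_translation)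
  then show ?thesis by (rule negligible_translation_rev)
qed

text \<open>
  A dual cell of a product is the sum of the dual cells of the factors, so the tiling by volumes applies
  to every partial sum. One set \<open>X\<close> serves all partial sums, because a partial sum that is not negligible
  forces the full sum not to be negligible.
\<close>

lemma mixed_volume_tiling:
  fixes M :: "'n::finite \<Rightarrow> ((real ^ 'n) \<times> real) set"
  assumes M: "\<And>i. finite (M i)" "\<And>i. M i \<noteq> {}" and X: "finite X"
    "\<And>x. \<not> negligible (convex hull (\<Sum>i\<in>UNIV. dual_cell (M i) x)) \<Longrightarrow> x \<in> X"
  shows "mixed_volume (\<lambda>i. fst ` M i) = (\<Sum>x\<in>X. mixed_volume (\<lambda>i. dual_cell (M i) x))"
proof -
  have "hull_volume (\<Sum>i\<in>S. fst ` M i) = (\<Sum>x\<in>X. hull_volume (\<Sum>i\<in>S. dual_cell (M i) x))" for S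
  proof -
    have "hull_volume (fst ` (\<Sum>i\<in>S. M i)) = (\<Sum>x\<in>X. hull_volume (dual_cell (\<Sum>i\<in>S. M i) x))"
    proof (rule hull_volume_tiling[OF _ X(1)])
      show "finite (\<Sum>i\<in>S. M i)" using M(1) by (intro finite_set_sum) auto
      fix x assume "\<not> negligible (convex hull (dual_cell (\<Sum>i\<in>S. M i) x))"
      then have "\<not> negligible (convex hull (\<Sum>i\<in>UNIV. dual_cell (M i) x))"
        using negligible_hull_sum_mono[of "\<lambda>i. dual_cell (M i) x" S] argmins_nonempty[OF M]
        by (auto simp: dual_cell_sum)
      then show "x \<in> X" by (rule X(2))
    qed
    then show ?thesis by (simp only: fst_image_set_sum dual_cell_sum)
  qed
  then show ?thesis
    unfolding mixed_volume_def by (subst sum.swap) (simp add: sum_distrib_left)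
qed

lemma finite_fat_mixed_cells:
  fixes M :: "'n::finite \<Rightarrow> ((real ^ 'n) \<times> real) set"
  assumes "\<And>i. finite (M i)"
  shows "finite {x. \<not> negligible (convex hull (\<Sum>i\<in>UNIV. dual_cell (M i) x))}"
proof -
  have "finite (\<Sum>i\<in>UNIV. M i)" using assms by (intro finite_set_sum) auto
  from finite_fat_dual_cells[OF this] show ?thesis by (simp add: dual_cell_sum)
qed

text \<open>
  The subsets with and without \<open>i\<close> are paired with opposite signs.
\<close>

lemma alternating_sum_insert_invariant:
  fixes f :: "'n::finite set \<Rightarrow> real"
  assumes f: "\<And>S. i \<notin> S \<Longrightarrow> f (insert i S) = f S"
  shows "(\<Sum>S\<in>UNIV. (-1) ^ (CARD('n) - card S) * f S) = 0"
proof -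
  define g where "g = (\<lambda>S. (-1::real) ^ (CARD('n) - card S) * f S)"
  have inj: "inj_on (insert i) (Pow (-{i}))" by (auto simp: inj_on_def)
  have "(UNIV :: 'n set set) = Pow (-{i}) \<union> insert i ` Pow (-{i})"
  proof (intro equalityI subsetI)
    fix S :: "'n set"
    show "S \<in> Pow (-{i}) \<union> insert i ` Pow (-{i})"
    proof (cases "i \<in> S")
      case True
      then have "S = insert i (S - {i})" "S - {i} \<in> Pow (-{i})" by blast+
      then show ?thesis by (metis UnI2 imageI)
    qed blast
  qed simp
  then have "sum g UNIV = sum g (Pow (-{i}) \<union> insert i ` Pow (-{i}))" by simp
  also have "\<dots> = sum g (Pow (-{i})) + sum g (insert i ` Pow (-{i}))"
    by (intro sum.union_disjoint) auto
  also have "sum g (insert i ` Pow (-{i})) = (\<Sum>S\<in>Pow (-{i}). g (insert i S))"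
    by (simp add: sum.reindex[OF inj])
  also have "\<dots> = (\<Sum>S\<in>Pow (-{i}). - g S)"
  proof (rule sum.cong[OF refl])
    fix S assume "S \<in> Pow (-{i})"
    then have iS: "i \<notin> S" by auto
    then have "card S < CARD('n)" by (intro psubset_card_mono) auto
    then have "(-1::real) ^ (CARD('n) - card S) = - ((-1) ^ (CARD('n) - Suc (card S)))"
      by (metis Suc_diff_Suc mult_minus1 power_Suc)
    then show "g (insert i S) = - g S"
      using iS f[OF iS] by (simp add: g_def)
  qed
  finally show ?thesis by (simp add: sum_negf g_def)
qed

text \<open>
  Adding the singleton to a partial sum is a translation, so the terms of the alternating sum cancel in
  pairs.
\<close>

lemma mixed_volume_singleton:
  fixes P :: "'n::finite \<Rightarrow> (real ^ 'n) set"
  assumes "P i = {p}"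
  shows "mixed_volume P = 0"
  unfolding mixed_volume_def
  by (rule alternating_sum_insert_invariant[of i]) (simp add: assms hull_volume_translate)

lemma negligible_hull_sum_pairs:
  fixes p q :: "'i::finite \<Rightarrow> 'a::euclidean_space"
  assumes "card S < DIM('a)"
  shows "negligible (convex hull (\<Sum>i\<in>S. {p i, q i}))"
proof -
  define W where "W = span ((\<lambda>i. q i - p i) ` S)"
  have "dim W \<le> card ((\<lambda>i. q i - p i) ` S)" unfolding W_def by (simp add: dim_le_card' finite_imageI)
  also have "\<dots> \<le> card S" by (simp add: card_image_le)
  finally have "negligible W" using assms by (intro negligible_lowdim) simp
  then have neg: "negligible ((+) (\<Sum>i\<in>S. p i) ` W)" by (rule negligible_translation)
  have "(\<Sum>i\<in>S. {p i, q i}) \<subseteq> (+) (\<Sum>i\<in>S. p i) ` W"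
  proof
    fix x assume "x \<in> (\<Sum>i\<in>S. {p i, q i})"
    then obtain s where s: "x = sum s S" "\<forall>i\<in>S. s i \<in> {p i, q i}" by (auto simp: set_sum_alt)
    have "s i - p i \<in> W" if "i \<in> S" for i
    proof -
      have "s i = p i \<or> s i = q i" using s(2) that by blast
      then show ?thesis unfolding W_def using that by (auto intro: span_base span_zero)
    qed
    then have "(\<Sum>i\<in>S. s i - p i) \<in> W" unfolding W_def by (intro span_sum) auto
    moreover have "x = (\<Sum>i\<in>S. p i) + (\<Sum>i\<in>S. s i - p i)" by (simp add: s(1) sum_subtractf)
    ultimately show "x \<in> (+) (\<Sum>i\<in>S. p i) ` W" by blast
  qed
  moreover have "convex ((+) (\<Sum>i\<in>S. p i) ` W)" by (simp add: W_def subspace_imp_convex convex_translation)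
  ultimately have "convex hull (\<Sum>i\<in>S. {p i, q i}) \<subseteq> (+) (\<Sum>i\<in>S. p i) ` W" by (simp add: hull_minimal)
  then show ?thesis using neg negligible_subset by blast
qed

lemma mixed_volume_pairs:
  fixes p q :: "'n::finite \<Rightarrow> real ^ 'n"
  shows "mixed_volume (\<lambda>i. {p i, q i}) = hull_volume (\<Sum>i\<in>UNIV. {p i, q i})"
proof -
  have "mixed_volume (\<lambda>i. {p i, q i})
      = (\<Sum>S\<in>{UNIV}. (-1) ^ (CARD('n) - card S) * hull_volume (\<Sum>i\<in>S. {p i, q i}))"
    unfolding mixed_volume_def
  proof (rule sum.mono_neutral_right)
    show "\<forall>S\<in>UNIV - {UNIV}. (-1) ^ (CARD('n) - card S) * hull_volume (\<Sum>i\<in>S. {p i, q i}) = 0"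
    proof
      fix S :: "'n set" assume "S \<in> UNIV - {UNIV}"
      then have "card S < CARD('n)" by (intro psubset_card_mono) auto
      then have "card S < DIM(real ^ 'n)" by simp
      from negligible_hull_sum_pairs[OF this]
      show "(-1) ^ (CARD('n) - card S) * hull_volume (\<Sum>i\<in>S. {p i, q i}) = 0"
        by (simp add: negligible_imp_measure0)
    qed
  qed auto
  then show ?thesis by simp
qed

lemma finite_bounded_integer_vectors:
  fixes B :: "(real ^ 'n::finite) set"
  assumes "bounded B"
  shows "finite {v \<in> B. \<forall>i. v $ i \<in> \<int>}"
proof -
  obtain b where b: "\<And>v. v \<in> B \<Longrightarrow> norm v \<le> b" using assms by (auto simp: bounded_iff)
  have "finite (PiE UNIV (\<lambda>_::'n. {x \<in> \<int>. -b \<le> x \<and> x \<le> b}))"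
    by (intro finite_PiE) (auto simp: finite_int_segment)
  moreover have "{v \<in> B. \<forall>i. v $ i \<in> \<int>} \<subseteq> vec_lambda ` PiE UNIV (\<lambda>_::'n. {x \<in> \<int>. -b \<le> x \<and> x \<le> b})"
  proof
    fix v assume v: "v \<in> {v \<in> B. \<forall>i. v $ i \<in> \<int>}"
    have "\<bar>v $ i\<bar> \<le> b" for i using b[of v] v component_le_norm_cart[of v i] by simp
    then have "- b \<le> v $ i \<and> v $ i \<le> b" for i by (simp add: abs_le_iff minus_le_iff)
    then have "vec_nth v \<in> PiE UNIV (\<lambda>_::'n. {x \<in> \<int>. -b \<le> x \<and> x \<le> b})"
      using v by (simp add: PiE_iff)
    then show "v \<in> vec_lambda ` PiE UNIV (\<lambda>_::'n. {x \<in> \<int>. -b \<le> x \<and> x \<le> b})"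
      by (intro image_eqI[of _ _ "vec_nth v"]) simp_all
  qed
  ultimately show ?thesis using finite_surj by blast
qed

text \<open>
  Cut the unit cube along the translates of \<open>K\<close> and move the pieces back into \<open>K\<close>. They do not overlap
  there, since distinct integer translates of the cube do not overlap.
\<close>

lemma volume_ge_1_if_integer_translates_cover:
  fixes K :: "(real ^ 'n::finite) set"
  assumes K: "compact K" and cover: "\<And>x. \<exists>v. (\<forall>i. v $ i \<in> \<int>) \<and> x - v \<in> K"
  shows "measure lebesgue K \<ge> 1"
proof -
  define Q :: "(real ^ 'n) set" where "Q = cbox 0 (\<chi> i. 1)"
  \<comment> \<open>The integer vectors whose translates of \<open>K\<close> meet the cube.\<close>
  define L where "L = {v \<in> {x - y | x y. x \<in> Q \<and> y \<in> K}. \<forall>i. v $ i \<in> \<int>}"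
  have "bounded {x - y | x y. x \<in> Q \<and> y \<in> K}"
    using K by (intro compact_imp_bounded compact_differences) (auto simp: Q_def)
  then have finL: "finite L" unfolding L_def by (rule finite_bounded_integer_vectors)
  have KL: "K \<in> lmeasurable" using K by (rule lmeasurable_compact)
  have meas: "(+) v ` K \<inter> Q \<in> lmeasurable" for v
    using K by (intro lmeasurable_compact compact_Int compact_translation) (auto simp: Q_def)
  define A where "A = (\<lambda>v. (+) (-v) ` ((+) v ` K \<inter> Q))"
  have Aalt: "A v = {y \<in> K. v + y \<in> Q}" for v by (force simp: A_def image_iff)
  have measA: "A v \<in> lmeasurable" for v unfolding A_def using meas by (rule measurable_translation)
  have neg: "negligible (A v \<inter> A u)" if vu: "v \<in> L" "u \<in> L" "v \<noteq> u" for v u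
  proof -
    obtain i where i: "v $ i \<noteq> u $ i" using vu(3) by (auto simp: vec_eq_iff)
    have int: "v $ i \<in> \<int>" "u $ i \<in> \<int>" using vu by (auto simp: L_def)
    then obtain m n where mn: "v $ i = of_int m" "u $ i = of_int n" by (auto elim!: Ints_cases)
    have "A v \<inter> A u \<subseteq> {y. axis i 1 \<bullet> y = 1 - max (v $ i) (u $ i)}"
    proof
      fix y assume "y \<in> A v \<inter> A u"
      then have "0 \<le> (v + y) $ i" "(v + y) $ i \<le> 1" "0 \<le> (u + y) $ i" "(u + y) $ i \<le> 1"
        by (auto simp: Aalt Q_def mem_box_cart)
      moreover have "real_of_int m + 1 \<le> real_of_int n \<or> real_of_int n + 1 \<le> real_of_int m"
      proof -
        have "m \<noteq> n" using i mn by auto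
        then have "m + 1 \<le> n \<or> n + 1 \<le> m" by linarith
        then show ?thesis by linarith
      qed
      ultimately have "y $ i = 1 - max (v $ i) (u $ i)" using mn by (auto simp: max_def)
      then show "y \<in> {y. axis i 1 \<bullet> y = 1 - max (v $ i) (u $ i)}" by (simp add: inner_axis' )
    qed
    moreover have "negligible {y. axis i (1::real) \<bullet> y = 1 - max (v $ i) (u $ i)}"
      by (intro negligible_hyperplane) (auto simp: axis_eq_0_iff)
    ultimately show ?thesis using negligible_subset by blast
  qed
  have "Q \<subseteq> (\<Union>v\<in>L. (+) v ` K \<inter> Q)"
  proof
    fix x assume x: "x \<in> Q"
    obtain v where v: "\<forall>i. v $ i \<in> \<int>" "x - v \<in> K" using cover by blast
    have "v = x - (x - v)" by simp
    then have "v \<in> L" using x v unfolding L_def by blast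
    moreover have "x \<in> (+) v ` K" using v(2) by (intro image_eqI[of _ _ "x - v"]) auto
    ultimately show "x \<in> (\<Union>v\<in>L. (+) v ` K \<inter> Q)" using x by blast
  qed
  then have "measure lebesgue Q \<le> measure lebesgue (\<Union>v\<in>L. (+) v ` K \<inter> Q)"
    using finL meas by (intro measure_mono_fmeasurable fmeasurable.finite_UN) (auto simp: Q_def)
  also have "\<dots> \<le> (\<Sum>v\<in>L. measure lebesgue ((+) v ` K \<inter> Q))"
    using finL meas by (intro measure_UNION_le) auto
  also have "\<dots> = (\<Sum>v\<in>L. measure lebesgue (A v))" unfolding A_def by (simp only: measure_translation)
  also have "\<dots> = measure lebesgue (\<Union>v\<in>L. A v)"
    using finL neg by (intro measure_negligible_finite_Union_image[symmetric]) (auto simp: pairwise_def measA)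
  also have "\<dots> \<le> measure lebesgue K"
    using finL KL measA by (intro measure_mono_fmeasurable) (auto simp: Aalt intro!: sets.finite_UN fmeasurableD)
  finally have "measure lebesgue Q \<le> measure lebesgue K" .
  moreover have "measure lebesgue Q = 1"
  proof -
    have "0 \<in> Q" by (simp add: Q_def mem_box_cart)
    then have "cbox 0 (\<chi> i. 1) \<noteq> ({} :: (real ^ 'n) set)" by (auto simp: Q_def)
    then show ?thesis by (simp add: Q_def content_cbox_cart)
  qed
  ultimately show ?thesis by simp
qed

definition indexed_independent :: "('i::finite \<Rightarrow> 'a::real_vector) \<Rightarrow> bool" where
  "indexed_independent v \<longleftrightarrow> (\<forall>a. (\<Sum>i\<in>UNIV. a i *\<^sub>R v i) = 0 \<longrightarrow> (\<forall>i. a i = 0))"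

lemma indexed_independent_basis:
  assumes "indexed_independent v"
  shows "inj v" "independent (range v)"
proof -
  show inj: "inj v"
  proof (rule injI, rule ccontr)
    fix i j assume ij: "v i = v j" "i \<noteq> j"
    define a where "a = (\<lambda>k. if k = i then 1 else if k = j then -1 else (0::real))"
    have "(\<Sum>k\<in>UNIV. a k *\<^sub>R v k) = (\<Sum>k\<in>{i,j}. a k *\<^sub>R v k)"
      by (intro sum.mono_neutral_right) (auto simp: a_def)
    also have "\<dots> = 0" using ij by (simp add: a_def)
    finally have "a i = 0" using assms unfolding indexed_independent_def by blast
    then show False by (simp add: a_def)
  qed
  show "independent (range v)"
  proof
    assume "dependent (range v)"
    then obtain u w where u: "w \<in> range v" "u w \<noteq> 0" "(\<Sum>x\<in>range v. u x *\<^sub>R x) = 0"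
      by (auto simp: dependent_finite)
    then have "(\<Sum>i\<in>UNIV. u (v i) *\<^sub>R v i) = 0" by (simp add: sum.reindex[OF inj])
    then have "\<forall>i. u (v i) = 0"
      using assms[unfolded indexed_independent_def, rule_format, of "\<lambda>i. u (v i)"] by blast
    then show False using u by auto
  qed
qed

text \<open>
  Rounding the coordinates with respect to the edges \<open>q i - p i\<close> shows that the translates of the
  parallelepiped by integer vectors cover the space.
\<close>

lemma mixed_volume_integer_pairs_ge_1:
  fixes p q :: "'n::finite \<Rightarrow> real ^ 'n"
  assumes int: "\<And>i j. p i $ j \<in> \<int>" "\<And>i j. q i $ j \<in> \<int>" and ind: "indexed_independent (\<lambda>i. q i - p i)"
  shows "mixed_volume (\<lambda>i. {p i, q i}) \<ge> 1"
  unfolding mixed_volume_pairs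
proof (rule volume_ge_1_if_integer_translates_cover)
  have "finite (\<Sum>i\<in>UNIV. {p i, q i})" by (intro finite_set_sum) auto
  then show "compact (convex hull (\<Sum>i\<in>UNIV. {p i, q i}))" by (rule finite_imp_compact_convex_hull)
  fix x :: "real ^ 'n"
  let ?v = "\<lambda>i. q i - p i"
  note basis = indexed_independent_basis[OF ind]
  have "span (range ?v) = UNIV"
    using basis by (simp add: dim_eq_full[symmetric] dim_eq_card_independent card_image)
  then have "x - (\<Sum>i\<in>UNIV. p i) \<in> span (range ?v)" by simp
  then obtain u where "x - (\<Sum>i\<in>UNIV. p i) = (\<Sum>w\<in>range ?v. u w *\<^sub>R w)"
    by (auto simp: span_finite)
  then have x: "x = (\<Sum>i\<in>UNIV. p i) + (\<Sum>i\<in>UNIV. u (?v i) *\<^sub>R ?v i)"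
    by (simp add: sum.reindex[OF basis(1)] algebra_simps)
  define t where "t = (\<lambda>i. u (?v i))"
  define w where "w = (\<Sum>i\<in>UNIV. of_int \<lfloor>t i\<rfloor> *\<^sub>R ?v i)"
  have "w $ j \<in> \<int>" for j unfolding w_def using int by (auto intro!: Ints_sum Ints_mult Ints_diff)
  moreover have "x - w \<in> convex hull (\<Sum>i\<in>UNIV. {p i, q i})"
  proof -
    have "x - w = (\<Sum>i\<in>UNIV. p i + frac (t i) *\<^sub>R ?v i)"
      by (simp add: x w_def t_def frac_def sum.distrib sum_subtractf algebra_simps)
    moreover have "p i + frac (t i) *\<^sub>R ?v i \<in> convex hull {p i, q i}" for i
    proof -
      have "0 \<le> frac (t i)" "frac (t i) \<le> 1" using frac_lt_1[of "t i"] by auto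
      then show ?thesis unfolding convex_hull_2_alt by blast
    qed
    ultimately have "x - w \<in> (\<Sum>i\<in>UNIV. convex hull {p i, q i})"
      by (auto simp: set_sum_alt)
    then show ?thesis by (simp add: convex_hull_set_sum)
  qed
  ultimately show "\<exists>v. (\<forall>i. v $ i \<in> \<int>) \<and> x - v \<in> convex hull (\<Sum>i\<in>UNIV. {p i, q i})" by blast
qed

section \<open>Generic lifts and positivity of mixed volumes\<close>

text \<open>
  Genericity is reduced to avoiding roots of finitely many polynomials. Outside \<open>T\<close> the lift takes
  distinct powers of a number \<open>R\<close> as values. If it agrees with a linear form on a dependent set \<open>B\<close>, then
  a fixed linear relation of \<open>B\<close> becomes a polynomial equation for \<open>R\<close>. This equation is nontrivial
  since \<open>T\<close> is independent, so the relation involves an element outside of \<open>T\<close>.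
\<close>

lemma exists_generic_lift:
  fixes E :: "'b::real_vector set"
  assumes E: "finite E" "T \<subseteq> E" "independent T"
  shows "\<exists>w :: 'b \<Rightarrow> real. (\<forall>z\<in>T. w z = 0) \<and> (\<forall>z\<in>E - T. w z > 0) \<and>
    (\<forall>B f. B \<subseteq> E \<longrightarrow> linear f \<longrightarrow> (\<forall>z\<in>B. w z = f z) \<longrightarrow> independent B)"
proof -
  obtain e :: "'b \<Rightarrow> nat" where e: "inj_on e E" using finite_imp_inj_to_nat_seg[OF E(1)] by blast
  define D where "D = {B. B \<subseteq> E \<and> dependent B}"
  have finD: "finite D" using E(1) by (simp add: D_def)
  have "\<exists>u. (\<Sum>z\<in>B. u z *\<^sub>R z) = 0 \<and> (\<exists>z\<in>B-T. u z \<noteq> 0)" if B: "B \<in> D" for B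
  proof -
    have finB: "finite B" "dependent B" using B E(1) finite_subset by (auto simp: D_def)
    then obtain u where u: "(\<Sum>z\<in>B. u z *\<^sub>R z) = 0" "\<exists>z\<in>B. u z \<noteq> 0" by (auto simp: dependent_finite)
    have "\<exists>z\<in>B-T. u z \<noteq> 0"
    proof (rule ccontr)
      assume no: "\<not> ?thesis"
      have "(\<Sum>z\<in>B\<inter>T. u z *\<^sub>R z) = (\<Sum>z\<in>B. u z *\<^sub>R z)"
        using no finB by (intro sum.mono_neutral_left) auto
      moreover have "\<exists>z\<in>B\<inter>T. u z \<noteq> 0" using u(2) no by blast
      ultimately have "dependent (B \<inter> T)" using u(1) finB by (auto simp: dependent_finite)
      then show False using E(3) independent_mono by blast
    qed
    then show ?thesis using u(1) by blast
  qed
  then obtain u where u: "\<And>B. B \<in> D \<Longrightarrow> (\<Sum>z\<in>B. u B z *\<^sub>R z) = 0 \<and> (\<exists>z\<in>B-T. u B z \<noteq> 0)" by metis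
  \<comment> \<open>The relation of \<open>B\<close> applied to the values of the lift, as a polynomial in \<open>R\<close>.\<close>
  define P where "P = (\<lambda>B. \<Sum>z\<in>B-T. Polynomial.monom (u B z) (e z))"
  have P: "P B \<noteq> 0" if B: "B \<in> D" for B
  proof -
    obtain y where y: "y \<in> B - T" "u B y \<noteq> 0" using u[OF B] by blast
    have BE: "B \<subseteq> E" "finite B" using B E(1) finite_subset by (auto simp: D_def)
    have "Polynomial.coeff (P B) (e y) = (\<Sum>z\<in>B-T. if z = y then u B z else 0)"
      unfolding P_def Polynomial.coeff_sum
    proof (rule sum.cong[OF refl])
      fix z assume "z \<in> B - T"
      then have "e z = e y \<longleftrightarrow> z = y" using e BE y(1) by (auto simp: inj_on_def)
      then show "Polynomial.coeff (Polynomial.monom (u B z) (e z)) (e y) = (if z = y then u B z else 0)" by simp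
    qed
    also have "\<dots> = u B y" using y BE by simp
    finally show ?thesis using y(2) by auto
  qed
  have "finite (\<Union>B\<in>D. {r. poly (P B) r = 0})" using finD P by (intro finite_UN_I poly_roots_finite) auto
  moreover have "infinite {0<..<1::real}" by (simp add: infinite_Ioo)
  ultimately have "\<not> {0<..<1} \<subseteq> (\<Union>B\<in>D. {r. poly (P B) r = 0})" using finite_subset by blast
  then obtain R where R: "R > 0" "\<And>B. B \<in> D \<Longrightarrow> poly (P B) R \<noteq> 0"
    unfolding subset_eq by (metis (mono_tags, lifting) UN_I greaterThanLessThan_iff mem_Collect_eq)
  define w where "w = (\<lambda>z. if z \<in> T then 0 else R ^ e z)"
  show ?thesis
  proof (intro exI[of _ w] conjI ballI allI impI)
    show "w z = 0" if "z \<in> T" for z using that by (simp add: w_def)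
    show "w z > 0" if "z \<in> E - T" for z using that R(1) by (simp add: w_def)
    fix B and f :: "'b \<Rightarrow> real" assume B: "B \<subseteq> E" and f: "linear f" "\<forall>z\<in>B. w z = f z"
    show "independent B"
    proof
      assume "dependent B"
      then have BD: "B \<in> D" using B by (simp add: D_def)
      have finB: "finite B" using B E(1) finite_subset by blast
      have "poly (P B) R = (\<Sum>z\<in>B-T. u B z * w z)"
        unfolding P_def poly_sum by (intro sum.cong) (auto simp: w_def Polynomial.poly_monom)
      also have "\<dots> = (\<Sum>z\<in>B. u B z * w z)"
        using finB by (intro sum.mono_neutral_left) (auto simp: w_def)
      also have "\<dots> = (\<Sum>z\<in>B. u B z * f z)" using f(2) by simp
      also have "\<dots> = f (\<Sum>z\<in>B. u B z *\<^sub>R z)" by (simp add: linear_sum[OF f(1)] linear_scale[OF f(1)])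
      also have "\<dots> = 0" using u[OF BD] by (simp add: linear_0[OF f(1)])
      finally show False using R(2)[OF BD] by simp
    qed
  qed
qed

text \<open>
  The Cayley trick: tagging a point of the \<open>i\<close>-th set by the \<open>i\<close>-th unit vector turns several affine
  conditions, one for each \<open>i\<close>, into a single linear condition.
\<close>

definition cayley :: "'n \<Rightarrow> real ^ 'n \<Rightarrow> (real ^ 'n) \<times> (real ^ 'n::finite)" where
  "cayley i q = (q, axis i 1)"

lemma cayley_eq_iff: "cayley i q = cayley j r \<longleftrightarrow> i = j \<and> q = r"
  by (auto simp: cayley_def axis_eq_axis)

text \<open>
  At every point \<open>x\<close>, a lift agrees with a linear form on the tagged exponents that are minimal at \<open>x\<close>. For
  a generic lift these are therefore linearly independent, and there are at most \<open>2 * CARD('n)\<close> of them.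
  So either some set has a single minimal exponent and the mixed volume vanishes, or every set has
  exactly two, and the mixed volume is a volume. The lift is zero on \<open>T\<close> and positive elsewhere, which
  makes \<open>T\<close> the dual cell at the origin.
\<close>

lemma exists_fine_lift:
  fixes C T :: "'n::finite \<Rightarrow> (real ^ 'n) set"
  assumes C: "\<And>i. finite (C i)" "\<And>i. C i \<noteq> {}" and T: "\<And>i. T i \<subseteq> C i"
    and ind: "independent (\<Union>i. cayley i ` T i)"
  obtains M :: "'n \<Rightarrow> ((real ^ 'n) \<times> real) set"
  where "\<And>i. finite (M i)" "\<And>i. fst ` M i = C i"
    "\<And>x. mixed_volume (\<lambda>i. dual_cell (M i) x) \<ge> 0"
    "(\<And>i. T i \<noteq> {}) \<Longrightarrow> (\<lambda>i. dual_cell (M i) 0) = T"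
proof -
  define E where "E = (\<Union>i. cayley i ` C i)"
  have E: "finite E" "(\<Union>i. cayley i ` T i) \<subseteq> E"
    unfolding E_def using C(1) by simp (intro UN_mono image_mono T subset_refl)
  from exists_generic_lift[OF E ind] obtain w :: "(real ^ 'n) \<times> (real ^ 'n) \<Rightarrow> real"
    where w: "(\<forall>z\<in>(\<Union>i. cayley i ` T i). w z = 0) \<and> (\<forall>z\<in>E - (\<Union>i. cayley i ` T i). w z > 0) \<and>
      (\<forall>B f. B \<subseteq> E \<longrightarrow> linear f \<longrightarrow> (\<forall>z\<in>B. w z = f z) \<longrightarrow> independent B)" ..
  note w0 = w[THEN conjunct1, rule_format]
    and wpos = w[THEN conjunct2, THEN conjunct1, rule_format]
    and wind = w[THEN conjunct2, THEN conjunct2, THEN spec, THEN spec, THEN mp, THEN mp, THEN mp]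
  define M where "M = (\<lambda>i. (\<lambda>q. (q, w (cayley i q))) ` C i)"
  have fin: "finite (M i)" and fst: "fst ` M i = C i" and ne: "M i \<noteq> {}" for i
    using C by (auto simp: M_def image_image)
  show thesis
  proof (rule that[OF fin fst])
    fix x
    define A where "A = (\<lambda>i. dual_cell (M i) x)"
    have AC: "A i \<subseteq> C i" for i using argmins_subset[of "M i" x] fst[of i] by (auto simp: A_def)
    have Ane: "A i \<noteq> {}" "finite (A i)" for i
      using argmins_nonempty[OF fin ne] finite_subset[OF AC C(1)] by (auto simp: A_def)
    have "\<exists>h. \<forall>q\<in>A i. q \<bullet> x + w (cayley i q) = h" for i
    proof -
      obtain m where m: "m \<in> argmins (M i) x" using argmins_nonempty[OF fin ne] by blast
      have "q \<bullet> x + w (cayley i q) = affine_value x m" if q: "q \<in> A i" for q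
      proof -
        obtain m' where m': "m' \<in> argmins (M i) x" "q = fst m'" using q by (auto simp: A_def)
        have "m' \<in> M i" using m'(1) argmins_subset by blast
        then have "snd m' = w (cayley i q)" using m'(2) by (auto simp: M_def)
        then show ?thesis using m' argmins_eq_iff[OF m] by (auto simp: affine_value_def)
      qed
      then show ?thesis by blast
    qed
    then obtain h where h: "\<And>i q. q \<in> A i \<Longrightarrow> q \<bullet> x + w (cayley i q) = h i" by metis
    define B where "B = (\<Union>i. cayley i ` A i)"
    \<comment> \<open>On \<open>A i\<close> the value \<open>q \<bullet> x + w (cayley i q)\<close> is the constant \<open>h i\<close>; solving for \<open>w\<close> gives a linear form.\<close>
    define f where "f = (\<lambda>z::(real^'n) \<times> (real^'n). snd z \<bullet> (\<chi> i. h i) - fst z \<bullet> x)"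
    have "independent B"
    proof (rule wind)
      show "B \<subseteq> E" using AC by (auto simp: B_def E_def)
      show "linear f" by (rule linearI) (auto simp: f_def algebra_simps)
      show "\<forall>z\<in>B. w z = f z"
      proof
        fix z assume "z \<in> B"
        then obtain i q where "q \<in> A i" "z = cayley i q" by (auto simp: B_def)
        then show "w z = f z" using h[of q i] by (simp add: f_def cayley_def inner_axis')
      qed
    qed
    then have "card B \<le> DIM((real^'n) \<times> (real^'n))" by (rule independent_card_le)
    then have "card B \<le> 2 * CARD('n)" by simp
    moreover have "card B = (\<Sum>i\<in>UNIV. card (A i))"
      unfolding B_def using Ane by (subst card_UN_disjoint) (auto simp: cayley_eq_iff card_image inj_on_def)
    ultimately have sum_le: "(\<Sum>i\<in>UNIV. card (A i)) \<le> (\<Sum>i\<in>(UNIV::'n set). 2)" by simp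
    have "mixed_volume A \<ge> 0"
    proof (cases "\<exists>i. card (A i) = 1")
      case True
      then obtain i p where "A i = {p}" by (auto simp: card_1_singleton_iff)
      then show ?thesis by (simp add: mixed_volume_singleton)
    next
      case False
      have ge: "2 \<le> card (A i)" for i
      proof -
        have "card (A i) \<noteq> 0" "card (A i) \<noteq> 1" using Ane False by auto
        then show ?thesis by linarith
      qed
      have "card (A i) = 2" for i
      proof (rule ccontr)
        assume "card (A i) \<noteq> 2"
        then have "2 < card (A i)" using ge[of i] by simp
        then have "(\<Sum>i\<in>(UNIV::'n set). 2) < (\<Sum>i\<in>UNIV. card (A i))"
          using ge by (intro sum_strict_mono_ex1) auto
        then show False using sum_le by simp
      qed
      then have "\<exists>p q. A i = {p, q}" for i by (metis card_2_iff)
      then obtain p q where "A = (\<lambda>i. {p i, q i})" by metis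
      then show ?thesis by (simp add: mixed_volume_pairs)
    qed
    then show "mixed_volume (\<lambda>i. dual_cell (M i) x) \<ge> 0" by (simp add: A_def)
  next
    assume Tne: "\<And>i. T i \<noteq> {}"
    show "(\<lambda>i. dual_cell (M i) 0) = T"
    proof
      fix i
      have zero: "w (cayley i q) = 0" if "q \<in> T i" for q using w0 that by blast
      have pos: "w (cayley i q) > 0" if "q \<in> C i - T i" for q
      proof (rule wpos)
        show "cayley i q \<in> E - (\<Union>i. cayley i ` T i)" using that by (auto simp: E_def cayley_eq_iff image_iff)
      qed
      have ge: "w (cayley i q) \<ge> 0" if "q \<in> C i" for q using zero[of q] pos[of q] that by force
      obtain t where t: "t \<in> T i" using Tne by blast
      have "dual_cell (M i) 0 = {q \<in> C i. \<forall>q'\<in>C i. w (cayley i q) \<le> w (cayley i q')}"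
        by (auto simp: M_def argmins_def affine_value_def image_iff)
      also have "\<dots> = T i"
      proof (intro equalityI subsetI)
        fix q assume "q \<in> {q \<in> C i. \<forall>q'\<in>C i. w (cayley i q) \<le> w (cayley i q')}"
        then have "q \<in> C i" "w (cayley i q) \<le> w (cayley i t)" using t T by auto
        then show "q \<in> T i" using zero[OF t] pos[of q] by fastforce
      qed (use zero ge T in auto)
      finally show "dual_cell (M i) 0 = T i" .
    qed
  qed
qed

text \<open>
  A generic lift without prescribed dual cells splits the mixed volume into nonnegative parts.
\<close>

lemma mixed_volume_nonneg:
  fixes C :: "'n::finite \<Rightarrow> (real ^ 'n) set"
  assumes C: "\<And>i. finite (C i)" "\<And>i. C i \<noteq> {}"
  shows "mixed_volume C \<ge> 0"
proof -
  have ind: "independent (\<Union>i. cayley i ` {})" by (simp add: independent_empty)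
  obtain M where M: "\<And>i. finite (M i)" "\<And>i. fst ` M i = C i" "\<And>x. mixed_volume (\<lambda>i. dual_cell (M i) x) \<ge> 0"
    by (rule exists_fine_lift[where C = C and T = "\<lambda>_. {}", OF C _ ind]) blast+
  have ne: "M i \<noteq> {}" for i using M(2)[of i] C(2)[of i] by auto
  have "mixed_volume (\<lambda>i. fst ` M i) \<ge> 0"
    using finite_fat_mixed_cells[of M] M(1,3)
    by (subst mixed_volume_tiling[OF M(1) ne]) (auto intro: sum_nonneg)
  then show ?thesis using M(2) by simp
qed

lemma independent_cayley_pairs:
  fixes p q :: "'n::finite \<Rightarrow> real ^ 'n"
  assumes "indexed_independent (\<lambda>i. q i - p i)"
  shows "independent (\<Union>i. cayley i ` {p i, q i})"
proof
  assume dep: "dependent (\<Union>i. cayley i ` {p i, q i})"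
  have neq: "p i \<noteq> q i" for i
  proof
    assume "p i = q i"
    then have "(\<Sum>j\<in>UNIV. (if j = i then 1 else 0) *\<^sub>R (q j - p j)) = 0" by (intro sum.neutral) auto
    then have "(if i = i then 1 else 0) = (0::real)"
      using assms[unfolded indexed_independent_def, rule_format, of "\<lambda>j. if j = i then 1 else 0" i] by blast
    then show False by simp
  qed
  have "finite (\<Union>i. cayley i ` {p i, q i})" by simp
  then obtain u where u: "(\<Sum>z\<in>(\<Union>i. cayley i ` {p i, q i}). u z *\<^sub>R z) = 0"
      "\<exists>z\<in>(\<Union>i. cayley i ` {p i, q i}). u z \<noteq> 0" using dep by (auto simp: dependent_finite)
  define a where "a = (\<lambda>i. u (cayley i (p i)))"
  define b where "b = (\<lambda>i. u (cayley i (q i)))"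
  have "(\<Sum>z\<in>(\<Union>i. cayley i ` {p i, q i}). u z *\<^sub>R z) = (\<Sum>i\<in>UNIV. \<Sum>z\<in>cayley i ` {p i, q i}. u z *\<^sub>R z)"
    by (rule sum.UNION_disjoint) (auto simp: cayley_eq_iff)
  also have "\<dots> = (\<Sum>i\<in>UNIV. a i *\<^sub>R cayley i (p i) + b i *\<^sub>R cayley i (q i))"
    using neq by (intro sum.cong) (auto simp: a_def b_def cayley_eq_iff)
  finally have 0: "(\<Sum>i\<in>UNIV. a i *\<^sub>R cayley i (p i) + b i *\<^sub>R cayley i (q i)) = 0" using u(1) by simp
  have ab: "a i + b i = 0" for i
  proof -
    have "0 = snd (\<Sum>i\<in>UNIV. a i *\<^sub>R cayley i (p i) + b i *\<^sub>R cayley i (q i)) $ i" using 0 by simp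
    also have "\<dots> = (\<Sum>j\<in>UNIV. (a j + b j) * (if i = j then 1 else 0))"
      by (simp add: snd_sum cayley_def axis_def algebra_simps)
    also have "\<dots> = (\<Sum>j\<in>UNIV. if j = i then a j + b j else 0)" by (rule sum.cong) auto
    finally show ?thesis by simp
  qed
  have "0 = fst (\<Sum>i\<in>UNIV. a i *\<^sub>R cayley i (p i) + b i *\<^sub>R cayley i (q i))" using 0 by simp
  also have "\<dots> = (\<Sum>i\<in>UNIV. b i *\<^sub>R (q i - p i))"
    unfolding fst_sum
  proof (rule sum.cong[OF refl])
    fix i :: 'n assume "i \<in> UNIV"
    have "a i = - b i" using ab[of i] by simp
    then show "fst (a i *\<^sub>R cayley i (p i) + b i *\<^sub>R cayley i (q i)) = b i *\<^sub>R (q i - p i)"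
      by (simp add: cayley_def algebra_simps)
  qed
  finally have "\<forall>i. b i = 0" using assms unfolding indexed_independent_def by metis
  then have "\<forall>i. a i = 0 \<and> b i = 0" using ab by (metis add.right_neutral)
  then show False using u(2) by (auto simp: a_def b_def)
qed

text \<open>
  Lift generically with \<open>{p i, q i}\<close> as the dual cells at the origin. All cells contribute nonnegative
  amounts, and the one at the origin contributes at least \<open>1\<close>.
\<close>

lemma mixed_volume_ge_1:
  fixes C :: "'n::finite \<Rightarrow> (real ^ 'n) set"
  assumes C: "\<And>i. finite (C i)" "\<And>i q j. q \<in> C i \<Longrightarrow> q $ j \<in> \<int>"
    and pq: "\<And>i. p i \<in> C i" "\<And>i. q i \<in> C i" "indexed_independent (\<lambda>i. q i - p i)"
  shows "mixed_volume C \<ge> 1"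
proof -
  have Cne: "C i \<noteq> {}" for i using pq(1) by blast
  have T: "{p i, q i} \<subseteq> C i" for i using pq by blast
  obtain M where M: "\<And>i. finite (M i)" "\<And>i. fst ` M i = C i" "\<And>x. mixed_volume (\<lambda>i. dual_cell (M i) x) \<ge> 0"
    and M0: "(\<And>i. {p i, q i} \<noteq> {}) \<Longrightarrow> (\<lambda>i. dual_cell (M i) 0) = (\<lambda>i. {p i, q i})"
    by (rule exists_fine_lift[where C = C and T = "\<lambda>i. {p i, q i}", OF C(1) Cne T independent_cayley_pairs[OF pq(3)]])
      blast
  have M4: "(\<lambda>i. dual_cell (M i) 0) = (\<lambda>i. {p i, q i})" by (rule M0) simp
  have ne: "M i \<noteq> {}" for i using M(2)[of i] Cne[of i] by auto
  \<comment> \<open>The origin may have to be added, as its cell is not yet known to be of full dimension.\<close>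
  define X where "X = insert 0 {x. \<not> negligible (convex hull (\<Sum>i\<in>UNIV. dual_cell (M i) x))}"
  have X: "finite X" using finite_fat_mixed_cells[of M] M(1) by (simp add: X_def)
  have "1 \<le> mixed_volume (\<lambda>i. {p i, q i})"
    by (intro mixed_volume_integer_pairs_ge_1 C(2)[OF pq(1)] C(2)[OF pq(2)] pq(3))
  also have "\<dots> = mixed_volume (\<lambda>i. dual_cell (M i) 0)" by (simp add: M4)
  also have "\<dots> \<le> (\<Sum>x\<in>X. mixed_volume (\<lambda>i. dual_cell (M i) x))"
    using M(3) X by (intro member_le_sum) (auto simp: X_def)
  also have "\<dots> = mixed_volume (\<lambda>i. fst ` M i)"
    by (rule mixed_volume_tiling[OF M(1) ne X, symmetric]) (auto simp: X_def)
  finally show ?thesis using M(2) by simp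
qed

section \<open>Stable intersections of tropical hypersurfaces\<close>

text \<open>
  Expanding the powers gives a sum over maps \<open>g\<close> of the index set to itself. The signs cancel unless \<open>g\<close>
  is surjective, that is, a permutation.
\<close>

lemma polarization:
  fixes f :: "'n::finite \<Rightarrow> real"
  shows "(\<Sum>S\<in>UNIV. (-1) ^ (CARD('n) - card S) * (\<Sum>i\<in>S. f i) ^ CARD('n)) = fact (CARD('n)) * (\<Prod>i\<in>UNIV. f i)"
proof -
  let ?n = "CARD('n)"
  define e where "e = (\<lambda>S::'n set. (-1::real) ^ (?n - card S))"
  have pow: "(\<Sum>i\<in>S. f i) ^ ?n = (\<Sum>g\<in>(UNIV :: ('n \<Rightarrow> 'n) set). (if range g \<subseteq> S then 1 else 0) * (\<Prod>j\<in>UNIV. f (g j)))" for S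
  proof -
    have "(\<Sum>i\<in>S. f i) ^ ?n = (\<Prod>j\<in>(UNIV::'n set). \<Sum>i\<in>S. f i)" by simp
    also have "\<dots> = (\<Sum>g\<in>PiE (UNIV::'n set) (\<lambda>_. S). \<Prod>j\<in>UNIV. f (g j))"
      using prod_sum_PiE[of "UNIV :: 'n set" "\<lambda>_. S" "\<lambda>_. f"] by simp
    also have "PiE UNIV (\<lambda>_. S) = {g :: 'n \<Rightarrow> 'n. range g \<subseteq> S}" by (auto simp: PiE_UNIV_domain)
    also have "(\<Sum>g\<in>{g :: 'n \<Rightarrow> 'n. range g \<subseteq> S}. \<Prod>j\<in>UNIV. f (g j))
      = (\<Sum>g\<in>(UNIV :: ('n \<Rightarrow> 'n) set). if g \<in> {g. range g \<subseteq> S} then \<Prod>j\<in>UNIV. f (g j) else 0)"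
      by (subst sum.If_cases) auto
    also have "\<dots> = (\<Sum>g\<in>(UNIV :: ('n \<Rightarrow> 'n) set). (if range g \<subseteq> S then 1 else 0) * (\<Prod>j\<in>UNIV. f (g j)))"
      by (intro sum.cong) auto
    finally show ?thesis .
  qed
  have alt: "(\<Sum>S\<in>UNIV. e S * (if R \<subseteq> S then 1 else 0)) = (if R = UNIV then 1 else 0)" for R :: "'n set"
  proof (cases "R = UNIV")
    case True
    have "(\<Sum>S\<in>UNIV. e S * (if R \<subseteq> S then 1 else 0)) = (\<Sum>S\<in>(UNIV :: 'n set set). if S = UNIV then 1 else 0)"
      by (intro sum.cong) (auto simp: True e_def)
    then show ?thesis using True by simp
  next
    case False
    then obtain i where "i \<notin> R" by blast
    then have "(\<Sum>S\<in>UNIV. e S * (if R \<subseteq> S then 1 else 0)) = 0"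
      unfolding e_def by (intro alternating_sum_insert_invariant[of i]) auto
    then show ?thesis using False by simp
  qed
  have surj: "{g :: 'n \<Rightarrow> 'n. range g = UNIV} = {g. g permutes UNIV}"
  proof (intro equalityI subsetI)
    fix g :: "'n \<Rightarrow> 'n" assume "g \<in> {g. range g = UNIV}"
    then have "bij g" using finite_UNIV_surj_inj[of g] by (simp add: bij_def)
    then show "g \<in> {g. g permutes UNIV}" by (auto intro: bij_imp_permutes)
  qed (auto dest: permutes_surj)
  have "(\<Sum>S\<in>UNIV. e S * (\<Sum>i\<in>S. f i) ^ ?n)
      = (\<Sum>g\<in>(UNIV :: ('n \<Rightarrow> 'n) set). \<Sum>S\<in>UNIV. e S * ((if range g \<subseteq> S then 1 else 0) * (\<Prod>j\<in>UNIV. f (g j))))"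
    unfolding pow sum_distrib_left by (rule sum.swap)
  also have "\<dots> = (\<Sum>g\<in>(UNIV :: ('n \<Rightarrow> 'n) set). (\<Prod>j\<in>UNIV. f (g j)) * (\<Sum>S\<in>UNIV. e S * (if range g \<subseteq> S then 1 else 0)))"
    by (simp add: sum_distrib_left mult_ac)
  also have "\<dots> = (\<Sum>g\<in>(UNIV :: ('n \<Rightarrow> 'n) set). if g \<in> {g. range g = UNIV} then \<Prod>j\<in>UNIV. f (g j) else 0)"
    unfolding alt by (intro sum.cong) auto
  also have "\<dots> = (\<Sum>g\<in>{g. g permutes UNIV}. \<Prod>j\<in>UNIV. f (g j))"
    by (subst sum.If_cases) (auto simp: surj)
  also have "\<dots> = (\<Sum>g\<in>{g. g permutes (UNIV::'n set)}. \<Prod>j\<in>UNIV. f j)"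
  proof (rule sum.cong[OF refl])
    fix g :: "'n \<Rightarrow> 'n" assume "g \<in> {g. g permutes UNIV}"
    then have "bij_betw g UNIV UNIV" by (auto simp: permutes_imp_bij)
    then show "(\<Prod>j\<in>UNIV. f (g j)) = (\<Prod>j\<in>UNIV. f j)" by (rule prod.reindex_bij_betw)
  qed
  also have "\<dots> = fact ?n * (\<Prod>i\<in>UNIV. f i)" by (simp add: card_permutations)
  finally show ?thesis by (simp add: e_def)
qed

definition lattice_simplex :: "nat \<Rightarrow> (real ^ 'n::finite) set" where
  "lattice_simplex d = {q. (\<forall>i. q $ i \<in> \<nat>) \<and> (\<Sum>i\<in>UNIV. q $ i) \<le> real d}"

lemma lattice_simplex_nonneg: "q \<in> lattice_simplex d \<Longrightarrow> 0 \<le> q $ i"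
  unfolding lattice_simplex_def by (metis (no_types, lifting) Nats_cases mem_Collect_eq of_nat_0_le_iff)

lemma finite_lattice_simplex: "finite (lattice_simplex d)"
proof -
  have "lattice_simplex d \<subseteq> {v \<in> cbox 0 (\<chi> i. real d). \<forall>i. v $ i \<in> \<int>}"
  proof
    fix q :: "real ^ 'n" assume q: "q \<in> lattice_simplex d"
    have nn: "0 \<le> q $ i" for i using lattice_simplex_nonneg[OF q] .
    have "q $ i \<le> d" for i
    proof -
      have "q $ i \<le> (\<Sum>i\<in>UNIV. q $ i)" using nn by (intro member_le_sum) auto
      then show ?thesis using q by (simp add: lattice_simplex_def)
    qed
    then show "q \<in> {v \<in> cbox 0 (\<chi> i. real d). \<forall>i. v $ i \<in> \<int>}"
      using nn q by (auto simp: lattice_simplex_def mem_box_cart Nats_subset_Ints[THEN subsetD])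
  qed
  then show ?thesis using finite_bounded_integer_vectors[OF bounded_cbox] finite_subset by blast
qed

lemma zero_in_lattice_simplex: "0 \<in> lattice_simplex d"
  by (simp add: lattice_simplex_def)

text \<open>
  The sum of the convex hulls is the standard simplex scaled by the sum of the degrees.
\<close>

lemma hull_volume_sum_lattice_simplices:
  fixes d :: "'n::finite \<Rightarrow> nat"
  shows "hull_volume (\<Sum>j\<in>S. lattice_simplex (d j) :: (real ^ 'n) set) = (\<Sum>j\<in>S. real (d j)) ^ CARD('n) / fact (CARD('n))"
proof -
  define D where "D = (\<Sum>j\<in>S. real (d j))"
  have D: "D \<ge> 0" by (simp add: D_def sum_nonneg)
  let ?P = "\<Sum>j\<in>S. lattice_simplex (d j) :: (real ^ 'n) set"
  let ?\<Delta> = "insert 0 Basis :: (real ^ 'n) set"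
  have std: "convex hull ?\<Delta> = {x. (\<forall>i. 0 \<le> x $ i) \<and> (\<Sum>i\<in>UNIV. x $ i) \<le> 1}"
  proof -
    have B: "Basis = range (\<lambda>i::'n. axis i (1::real))" by (auto simp: Basis_vec_def)
    have "inj (\<lambda>i::'n. axis i (1::real))" by (auto simp: inj_on_def axis_eq_axis)
    then have "(\<Sum>b\<in>Basis. x \<bullet> b) = (\<Sum>i\<in>UNIV. x $ i)" for x :: "real ^ 'n"
      unfolding B by (simp add: sum.reindex inner_axis)
    moreover have "(\<forall>b\<in>Basis. 0 \<le> x \<bullet> b) \<longleftrightarrow> (\<forall>i. 0 \<le> x $ i)" for x :: "real ^ 'n"
      unfolding B by (simp add: inner_axis)
    ultimately show ?thesis unfolding std_simplex by simp
  qed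
  have "convex hull ?P = (\<lambda>x. D *\<^sub>R x) ` (convex hull ?\<Delta>)"
  proof
    have "?P \<subseteq> (\<lambda>x. D *\<^sub>R x) ` (convex hull ?\<Delta>)"
    proof
      fix q assume "q \<in> ?P"
      then obtain s where s: "q = sum s S" "\<forall>j\<in>S. s j \<in> lattice_simplex (d j)" by (auto simp: set_sum_alt)
      have nn: "0 \<le> q $ i" for i
        using s lattice_simplex_nonneg by (auto intro!: sum_nonneg)
      have "(\<Sum>i\<in>UNIV. q $ i) = (\<Sum>j\<in>S. \<Sum>i\<in>UNIV. s j $ i)" unfolding s(1) by (simp add: sum.swap[of _ S])
      also have "\<dots> \<le> D" unfolding D_def using s(2) by (intro sum_mono) (auto simp: lattice_simplex_def)
      finally have le: "(\<Sum>i\<in>UNIV. q $ i) \<le> D" .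
      show "q \<in> (\<lambda>x. D *\<^sub>R x) ` (convex hull ?\<Delta>)"
      proof (cases "D = 0")
        case True
        have "(\<Sum>i\<in>UNIV. q $ i) = 0" using le True nn by (intro antisym sum_nonneg) auto
        then have "\<forall>i. q $ i = 0" using nn by (simp add: sum_nonneg_eq_0_iff)
        then have "q = 0" by (simp add: vec_eq_iff)
        moreover have "0 \<in> convex hull ?\<Delta>" by (simp add: hull_inc)
        ultimately show ?thesis by (intro image_eqI[of _ _ 0]) auto
      next
        case False
        then have "D > 0" using D by simp
        moreover have "(1 / D) *\<^sub>R q \<in> convex hull ?\<Delta>"
          unfolding std using nn le \<open>D > 0\<close> by (auto simp: sum_divide_distrib[symmetric])
        ultimately show ?thesis by (intro image_eqI[of _ _ "(1 / D) *\<^sub>R q"]) auto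
      qed
    qed
    moreover have "convex ((\<lambda>x. D *\<^sub>R x) ` (convex hull ?\<Delta>))" by (simp add: convex_scaling)
    ultimately show "convex hull ?P \<subseteq> (\<lambda>x. D *\<^sub>R x) ` (convex hull ?\<Delta>)" by (rule hull_minimal)
  next
    have "(\<lambda>x. D *\<^sub>R x) ` ?\<Delta> \<subseteq> ?P"
    proof
      fix y assume "y \<in> (\<lambda>x. D *\<^sub>R x) ` ?\<Delta>"
      then consider "y = 0" | b where "b \<in> Basis" "y = D *\<^sub>R b" by auto
      then show "y \<in> ?P"
      proof cases
        case 1
        then show ?thesis using zero_in_lattice_simplex
          by (auto simp: set_sum_alt intro!: exI[of _ "\<lambda>_. 0"])
      next
        case 2
        then obtain i where "b = axis i 1" by (auto simp: Basis_vec_def)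
        then have "real (d j) *\<^sub>R b \<in> lattice_simplex (d j)" for j
          by (auto simp: lattice_simplex_def axis_def if_distrib cong: if_cong)
        moreover have "y = (\<Sum>j\<in>S. real (d j) *\<^sub>R b)" by (simp add: 2 D_def scaleR_sum_left)
        ultimately show ?thesis by (auto simp: set_sum_alt)
      qed
    qed
    then show "(\<lambda>x. D *\<^sub>R x) ` (convex hull ?\<Delta>) \<subseteq> convex hull ?P"
      by (simp add: convex_hull_scaling[symmetric] hull_mono)
  qed
  then have "hull_volume ?P = measure lebesgue ((\<lambda>x. D *\<^sub>R x + 0) ` (convex hull ?\<Delta>))" by simp
  also have "\<dots> = \<bar>D\<bar> ^ DIM(real ^ 'n) * measure lebesgue (convex hull ?\<Delta>)"
    by (rule measure_lebesgue_affine)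
  also have "measure lebesgue (convex hull ?\<Delta>) = measure lborel (convex hull ?\<Delta>)"
    by (intro measure_completion borel_closed[THEN sets_lborel[THEN equalityD2, THEN subsetD]] compact_imp_closed finite_imp_compact_convex_hull) auto
  also have "\<dots> = 1 / fact (DIM(real ^ 'n))" by (rule content_std_simplex)
  finally show ?thesis using D by (simp add: D_def)
qed

lemma mixed_volume_lattice_simplices:
  "mixed_volume (\<lambda>j::'n::finite. lattice_simplex (d j)) = (\<Prod>j\<in>UNIV. real (d j))"
  using polarization[of "\<lambda>j. real (d j)"]
  by (simp add: mixed_volume_def hull_volume_sum_lattice_simplices sum_divide_distrib[symmetric])

text \<open>
  For the sets of minimal exponents of \<open>n\<close> tropical polynomials at a point, this says that the point is a
  stable intersection point of their hypersurfaces.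
\<close>

definition transversal :: "('n::finite \<Rightarrow> (real ^ 'n) set) \<Rightarrow> bool" where
  "transversal C \<longleftrightarrow> (\<exists>p q. (\<forall>i. p i \<in> C i \<and> q i \<in> C i) \<and> indexed_independent (\<lambda>i. q i - p i))"

text \<open>
  The mixed volumes of the dual cells add up to the product of the degrees, are nonnegative, and are at
  least \<open>1\<close> at each point that is counted.
\<close>

theorem tropical_Bezout:
  fixes M :: "'n::finite \<Rightarrow> ((real ^ 'n) \<times> real) set"
  assumes M: "\<And>i. finite (M i)" "\<And>i. fst ` M i = lattice_simplex (d i)"
  shows "finite {x. transversal (\<lambda>i. dual_cell (M i) x)}"
    and "card {x. transversal (\<lambda>i. dual_cell (M i) x)} \<le> (\<Prod>i\<in>UNIV. d i)"
proof -
  define X where "X = {x. \<not> negligible (convex hull (\<Sum>i\<in>UNIV. dual_cell (M i) x))}"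
  define Y where "Y = {x. transversal (\<lambda>i. dual_cell (M i) x)}"
  have X: "finite X" unfolding X_def by (rule finite_fat_mixed_cells[OF M(1)])
  have ne: "M i \<noteq> {}" for i using M(2)[of i] zero_in_lattice_simplex[of "d i"] by auto
  have fin: "finite (dual_cell (M i) x)" for i x using M(1) by (auto simp: argmins_def)
  have cell: "dual_cell (M i) x \<subseteq> lattice_simplex (d i)" for i x
    using M(2)[of i] argmins_subset[of "M i" x] by blast
  have nonneg: "mixed_volume (\<lambda>i. dual_cell (M i) x) \<ge> 0" for x
    by (rule mixed_volume_nonneg[OF fin]) (simp add: argmins_nonempty M(1) ne)
  have ge1: "mixed_volume (\<lambda>i. dual_cell (M i) x) \<ge> 1" if xY: "x \<in> Y" for x
  proof -
    obtain p q where pq: "\<And>i. p i \<in> dual_cell (M i) x" "\<And>i. q i \<in> dual_cell (M i) x"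
      "indexed_independent (\<lambda>i. q i - p i)" using xY unfolding Y_def transversal_def by blast
    show ?thesis
    proof (rule mixed_volume_ge_1[OF fin _ pq])
      fix i z j assume "z \<in> dual_cell (M i) x"
      then show "z $ j \<in> \<int>" using cell Nats_subset_Ints by (fastforce simp: lattice_simplex_def)
    qed
  qed
  have YX: "Y \<subseteq> X"
  proof
    fix x assume x: "x \<in> Y"
    show "x \<in> X"
    proof (rule ccontr)
      assume "x \<notin> X"
      then have "negligible (convex hull (\<Sum>i\<in>UNIV. dual_cell (M i) x))" by (simp add: X_def)
      then have "negligible (convex hull (\<Sum>i\<in>S. dual_cell (M i) x))" for S
        by (rule negligible_hull_sum_mono[rotated]) (simp add: argmins_nonempty M(1) ne)
      then have "mixed_volume (\<lambda>i. dual_cell (M i) x) = 0"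
        by (simp add: mixed_volume_def negligible_imp_measure0)
      then show False using ge1[OF x] by simp
    qed
  qed
  then show "finite {x. transversal (\<lambda>i. dual_cell (M i) x)}" using X finite_subset by (auto simp: Y_def)
  have "real (card Y) = (\<Sum>x\<in>Y. 1)" by simp
  also have "\<dots> \<le> (\<Sum>x\<in>Y. mixed_volume (\<lambda>i. dual_cell (M i) x))" by (intro sum_mono ge1)
  also have "\<dots> \<le> (\<Sum>x\<in>X. mixed_volume (\<lambda>i. dual_cell (M i) x))"
    using X YX nonneg by (intro sum_mono2) auto
  also have "\<dots> = mixed_volume (\<lambda>i. fst ` M i)"
    by (rule mixed_volume_tiling[OF M(1) ne X, symmetric]) (simp add: X_def)
  also have "\<dots> = (\<Prod>i\<in>UNIV. real (d i))" by (simp add: M(2) mixed_volume_lattice_simplices)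
  finally have "real (card Y) \<le> real (\<Prod>i\<in>UNIV. d i)" by simp
  then show "card {x. transversal (\<lambda>i. dual_cell (M i) x)} \<le> (\<Prod>i\<in>UNIV. d i)"
    unfolding Y_def by linarith
qed

section \<open>Counting vertices by transversal choices\<close>

lemma transversal_permute:
  fixes D :: "nat \<Rightarrow> (real ^ 'n::finite) set"
  assumes "transversal (\<lambda>j. D (\<tau> j))" "image_mset \<tau> (mset_set UNIV) = image_mset \<sigma> (mset_set (UNIV :: 'n set))"
  shows "transversal (\<lambda>j. D (\<sigma> j))"
proof -
  obtain \<pi> where \<pi>: "\<pi> permutes (UNIV :: 'n set)" "\<And>x. \<tau> x = \<sigma> (\<pi> x)"
    using image_mset_eq_implies_permutes[OF finite assms(2)] by auto
  obtain p q where pq: "\<And>j. p j \<in> D (\<tau> j)" "\<And>j. q j \<in> D (\<tau> j)" "indexed_independent (\<lambda>j. q j - p j)"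
    using assms(1) unfolding transversal_def by blast
  have bij: "bij \<pi>" using \<pi>(1) by (rule permutes_bij)
  define \<rho> where "\<rho> = inv_into UNIV \<pi>"
  have \<rho>: "\<rho> (\<pi> j) = j" "\<pi> (\<rho> j) = j" for j
    unfolding \<rho>_def using permutes_inverses[OF \<pi>(1)] by auto
  have inv: "\<sigma> j = \<tau> (\<rho> j)" for j using \<pi>(2)[of "\<rho> j"] by (simp add: \<rho>)
  show ?thesis
    unfolding transversal_def
  proof (intro exI conjI allI)
    show "p (\<rho> j) \<in> D (\<sigma> j)" "q (\<rho> j) \<in> D (\<sigma> j)" for j using pq(1,2) by (simp_all add: inv)
    show "indexed_independent (\<lambda>j. q (\<rho> j) - p (\<rho> j))"
      unfolding indexed_independent_def
    proof (intro allI impI)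
      fix a j assume 0: "(\<Sum>j\<in>UNIV. a j *\<^sub>R (q (\<rho> j) - p (\<rho> j))) = 0"
      have "(\<Sum>i\<in>UNIV. a (\<pi> i) *\<^sub>R (q i - p i)) = (\<Sum>i\<in>UNIV. a (\<pi> i) *\<^sub>R (q (\<rho> (\<pi> i)) - p (\<rho> (\<pi> i))))"
        by (simp add: \<rho>)
      also have "\<dots> = (\<Sum>j\<in>UNIV. a j *\<^sub>R (q (\<rho> j) - p (\<rho> j)))"
        by (rule sum.reindex_bij_betw[OF bij])
      finally have "\<forall>i. a (\<pi> i) = 0"
        using 0 pq(3)[unfolded indexed_independent_def, rule_format, of "\<lambda>i. a (\<pi> i)"] by simp
      then show "a j = 0" by (metis \<rho>(2))
    qed
  qed
qed

lemma indexed_independent_exchange: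
  fixes v :: "'i::finite \<Rightarrow> 'a::real_vector"
  assumes v: "indexed_independent v" and u: "u = (\<Sum>l\<in>UNIV. a l *\<^sub>R v l)" "a j \<noteq> 0"
  shows "indexed_independent (v(j := u))"
  unfolding indexed_independent_def
proof (intro allI impI)
  fix c l assume 0: "(\<Sum>l\<in>UNIV. c l *\<^sub>R (v(j := u)) l) = 0"
  have "(\<Sum>l\<in>UNIV. c l *\<^sub>R (v(j := u)) l) = c j *\<^sub>R u + (\<Sum>l\<in>UNIV - {j}. c l *\<^sub>R v l)"
    by (subst sum.remove[of _ j]) (auto intro!: sum.cong)
  also have "(\<Sum>l\<in>UNIV - {j}. c l *\<^sub>R v l) = (\<Sum>l\<in>UNIV. (if l = j then 0 else c l) *\<^sub>R v l)"
    by (intro sum.mono_neutral_cong_left) auto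
  also have "c j *\<^sub>R u + \<dots> = (\<Sum>l\<in>UNIV. (c j * a l + (if l = j then 0 else c l)) *\<^sub>R v l)"
    by (simp add: u(1) scaleR_sum_right sum.distrib scaleR_add_left)
  finally have "\<forall>l. c j * a l + (if l = j then 0 else c l) = 0"
    using 0 v[unfolded indexed_independent_def, rule_format, of "\<lambda>l. c j * a l + (if l = j then 0 else c l)"] by simp
  then have *: "c j * a l + (if l = j then 0 else c l) = 0" for l by blast
  have "c j = 0" using *[of j] u(2) by simp
  then show "c l = 0" using *[of l] by (cases "l = j") auto
qed

text \<open>
  Transversality does not depend on the order of the sets, so choices are recorded as multisets. Repeated
  indices are allowed: a vertex may need several differences from the same polynomial.
\<close>

definition transversal_choice :: "(nat \<Rightarrow> (real ^ 'n::finite) set) \<Rightarrow> nat multiset \<Rightarrow> bool" where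
  "transversal_choice D m \<longleftrightarrow> (\<exists>\<tau> :: 'n \<Rightarrow> nat. image_mset \<tau> (mset_set UNIV) = m \<and> transversal (\<lambda>j. D (\<tau> j)))"

text \<open>
  Take a basis among the differences, with \<open>v j\<close> coming from the index \<open>\<tau> j\<close>. It uses at most
  \<open>CARD('n)\<close> indices. For each unused index, exchanging a suitable basis vector against a nonzero
  difference of that index gives a further choice. These choices are distinct, as the new index occurs in
  none of the others.
\<close>

lemma many_transversal_choices:
  fixes D :: "nat \<Rightarrow> (real ^ 'n::finite) set"
  assumes ne: "\<And>i. i < k \<Longrightarrow> \<exists>p\<in>D i. \<exists>q\<in>D i. p \<noteq> q"
    and span: "span (\<Union>i<k. {q - p | p q. p \<in> D i \<and> q \<in> D i}) = UNIV"
    and k: "CARD('n) \<le> k"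
  shows "k - CARD('n) + 1 \<le> card {m \<in> multisets_of_size {..<k} CARD('n). transversal_choice D m}"
proof -
  let ?n = "CARD('n)"
  let ?W = "\<Union>i<k. {q - p | p q. p \<in> D i \<and> q \<in> D i}"
  obtain B where B: "B \<subseteq> ?W" "independent B" "?W \<subseteq> span B" "card B = dim ?W" using basis_exists[of ?W] by blast
  have "dim ?W = DIM(real ^ 'n)" using span by (simp only: dim_eq_full)
  then have cardB: "card B = ?n" using B(4) by simp
  have "finite B" using B(2) by (rule finiteI_independent)
  then obtain v where v: "bij_betw v (UNIV :: 'n set) B"
    using finite_same_card_bij[OF finite \<open>finite B\<close>, of "UNIV :: 'n set"] cardB by metis
  have inj: "inj v" and range: "range v = B" using v by (auto simp: bij_betw_def)
  have spanB: "span B = UNIV" using span_minimal[OF B(3) subspace_span] span by auto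
  have indv: "indexed_independent v"
    unfolding indexed_independent_def
  proof (intro allI impI)
    fix a i assume 0: "(\<Sum>i\<in>UNIV. a i *\<^sub>R v i) = 0"
    have "(\<Sum>x\<in>B. a (inv_into UNIV v x) *\<^sub>R x) = (\<Sum>i\<in>UNIV. a i *\<^sub>R v i)"
      unfolding range[symmetric] by (simp add: sum.reindex[OF inj] inv_f_f[OF inj])
    then have "\<forall>x\<in>B. a (inv_into UNIV v x) = 0"
      using 0 B(2) \<open>finite B\<close> independentD[of B B "\<lambda>x. a (inv_into UNIV v x)"] by auto
    then have "a (inv_into UNIV v (v i)) = 0" using range by blast
    then show "a i = 0" using inj by simp
  qed
  have "\<exists>t p q. t < k \<and> p \<in> D t \<and> q \<in> D t \<and> v j = q - p" for j
  proof -
    have "v j \<in> ?W" using B(1) range by blast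
    then show ?thesis by blast
  qed
  then obtain \<tau> p q where \<tau>: "\<And>j. \<tau> j < k" "\<And>j. p j \<in> D (\<tau> j)" "\<And>j. q j \<in> D (\<tau> j)" "\<And>j. v j = q j - p j"
    by metis
  define R where "R = range \<tau>"
  have exch: "\<exists>j. transversal (\<lambda>l. D ((\<tau>(j := i)) l))" if i: "i < k" for i
  proof -
    obtain r s where rs: "r \<in> D i" "s \<in> D i" "r \<noteq> s" using ne[OF i] by blast
    have "s - r \<in> span (range v)" using spanB range by simp
    then obtain w where "s - r = (\<Sum>x\<in>range v. w x *\<^sub>R x)" by (auto simp: span_finite)
    then have u: "s - r = (\<Sum>l\<in>UNIV. w (v l) *\<^sub>R v l)" by (simp add: sum.reindex[OF inj])
    have "\<exists>j. w (v j) \<noteq> 0"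
    proof (rule ccontr)
      assume "\<not> ?thesis"
      then have "s - r = 0" unfolding u by simp
      then show False using rs(3) by simp
    qed
    then obtain j where j: "w (v j) \<noteq> 0" by blast
    have "indexed_independent (v(j := s - r))" by (rule indexed_independent_exchange[OF indv u j])
    moreover have "v(j := s - r) = (\<lambda>l. (q(j := s)) l - (p(j := r)) l)" using \<tau>(4) by auto
    ultimately have "indexed_independent (\<lambda>l. (q(j := s)) l - (p(j := r)) l)" by simp
    moreover have "(p(j := r)) l \<in> D ((\<tau>(j := i)) l) \<and> (q(j := s)) l \<in> D ((\<tau>(j := i)) l)" for l
      using \<tau>(2,3) rs by simp
    ultimately show ?thesis unfolding transversal_def by blast
  qed
  then obtain J where J: "\<And>i. i < k \<Longrightarrow> transversal (\<lambda>l. D ((\<tau>(J i := i)) l))" by metis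
  define g where "g = (\<lambda>i. image_mset (\<tau>(J i := i)) (mset_set (UNIV :: 'n set)))"
  have set_g: "i \<in># g i" "set_mset (g i) \<subseteq> insert i R" for i by (auto simp: g_def R_def)
  have inj_g: "inj_on g ({..<k} - R)"
  proof (rule inj_onI)
    fix i i' assume "i \<in> {..<k} - R" "i' \<in> {..<k} - R" "g i = g i'"
    then show "i = i'" using set_g(1)[of i] set_g(2)[of i'] by auto
  qed
  \<comment> \<open>The choice made by the basis itself accounts for the summand \<open>1\<close>.\<close>
  define m0 where "m0 = image_mset \<tau> (mset_set (UNIV :: 'n set))"
  have m0: "m0 \<notin> g ` ({..<k} - R)"
  proof
    assume "m0 \<in> g ` ({..<k} - R)"
    then obtain i where "i \<in> {..<k} - R" "m0 = g i" by blast
    moreover from this have "i \<in># m0" using set_g(1)[of i] by simp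
    moreover have "set_mset m0 = R" by (simp add: m0_def R_def)
    ultimately show False by blast
  qed
  have fin: "finite {m \<in> multisets_of_size {..<k} ?n. transversal_choice D m}"
    by (simp add: finite_multisets_of_size)
  have good0: "m0 \<in> {m \<in> multisets_of_size {..<k} ?n. transversal_choice D m}"
  proof -
    have "v = (\<lambda>j. q j - p j)" using \<tau>(4) by (rule ext)
    then have "transversal (\<lambda>j. D (\<tau> j))" unfolding transversal_def using \<tau>(2,3) indv by blast
    then show ?thesis using \<tau>(1) by (auto simp: multisets_of_size_def transversal_choice_def m0_def)
  qed
  have good: "g i \<in> {m \<in> multisets_of_size {..<k} ?n. transversal_choice D m}" if "i < k" for i
  proof -
    have "set_mset (g i) \<subseteq> {..<k}" using set_g(2)[of i] \<tau>(1) that by (auto simp: R_def)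
    then have "g i \<in> multisets_of_size {..<k} ?n" by (simp add: multisets_of_size_def g_def)
    moreover have "transversal_choice D (g i)"
      unfolding transversal_choice_def g_def using J[OF that] by blast
    ultimately show ?thesis by blast
  qed
  have "card R \<le> ?n" unfolding R_def by (rule card_image_le) simp
  then have "k - ?n + 1 \<le> card ({..<k} - R) + 1" using diff_card_le_card_Diff[of R "{..<k}"] by (simp add: R_def)
  also have "\<dots> = card (insert m0 (g ` ({..<k} - R)))" using m0 by (simp add: card_image[OF inj_g])
  also have "\<dots> \<le> card {m \<in> multisets_of_size {..<k} ?n. transversal_choice D m}"
    using good0 good by (intro card_mono fin) auto
  finally show ?thesis .
qed

text \<open>
  Double counting of the pairs of a vertex and a multiset of indices that is a transversal choice there.
\<close>

theorem card_tropical_vertices: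
  fixes N :: "nat \<Rightarrow> ((real ^ 'n::finite) \<times> real) set"
  assumes N: "\<And>i. i < k \<Longrightarrow> finite (N i)" "\<And>i. i < k \<Longrightarrow> fst ` N i = lattice_simplex (e i)"
    and e: "\<And>i. i < k \<Longrightarrow> e i \<le> d" and k: "CARD('n) \<le> k"
    and W: "\<And>x i. x \<in> W \<Longrightarrow> i < k \<Longrightarrow> \<exists>p\<in>dual_cell (N i) x. \<exists>q\<in>dual_cell (N i) x. p \<noteq> q"
      "\<And>x. x \<in> W \<Longrightarrow> span (\<Union>i<k. {q - p | p q. p \<in> dual_cell (N i) x \<and> q \<in> dual_cell (N i) x}) = UNIV"
  shows "finite W" "card W * (k - CARD('n) + 1) \<le> ((k + CARD('n) - 1) choose CARD('n)) * d ^ CARD('n)"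
proof -
  let ?n = "CARD('n)"
  define MS where "MS = multisets_of_size {..<k} ?n"
  define good where "good = (\<lambda>x. transversal_choice (\<lambda>i. dual_cell (N i) x))"
  have finMS: "finite MS" by (simp add: MS_def finite_multisets_of_size)
  have many: "k - ?n + 1 \<le> card {m \<in> MS. good x m}" if "x \<in> W" for x
    unfolding MS_def good_def using W that by (intro many_transversal_choices k) auto
  have few: "finite {x. good x m} \<and> card {x. good x m} \<le> d ^ ?n" if m: "m \<in> MS" for m
  proof (cases "\<exists>\<sigma> :: 'n \<Rightarrow> nat. image_mset \<sigma> (mset_set UNIV) = m")
    case True
    then obtain \<sigma> :: "'n \<Rightarrow> nat" where \<sigma>: "image_mset \<sigma> (mset_set UNIV) = m" by blast
    have lt: "\<sigma> j < k" for j
    proof -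
      have "\<sigma> j \<in> set_mset m" by (simp flip: \<sigma>)
      moreover have "set_mset m \<subseteq> {..<k}" using m by (simp add: MS_def multisets_of_size_def)
      ultimately show ?thesis by blast
    qed
    have sub: "{x. good x m} \<subseteq> {x. transversal (\<lambda>j. dual_cell (N (\<sigma> j)) x)}"
    proof clarify
      fix x assume "good x m"
      then obtain \<tau> :: "'n \<Rightarrow> nat" where "image_mset \<tau> (mset_set UNIV) = m"
        "transversal (\<lambda>j. dual_cell (N (\<tau> j)) x)" unfolding good_def transversal_choice_def by blast
      then show "transversal (\<lambda>j. dual_cell (N (\<sigma> j)) x)"
        using transversal_permute[of "\<lambda>i. dual_cell (N i) x" \<tau> \<sigma>] \<sigma> by simp
    qed
    have fin: "finite {x. transversal (\<lambda>j. dual_cell (N (\<sigma> j)) x)}"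
      by (rule tropical_Bezout(1)[of "\<lambda>j. N (\<sigma> j)" "\<lambda>j. e (\<sigma> j)"]) (simp_all add: N lt)
    have "card {x. transversal (\<lambda>j. dual_cell (N (\<sigma> j)) x)} \<le> (\<Prod>j\<in>UNIV. e (\<sigma> j))"
      by (rule tropical_Bezout(2)) (simp_all add: N lt)
    also have "\<dots> \<le> (\<Prod>j\<in>(UNIV::'n set). d)" by (intro prod_mono) (simp add: e lt)
    finally show ?thesis using card_mono[OF fin sub] finite_subset[OF sub fin] by simp
  next
    case False
    then show ?thesis by (simp add: good_def transversal_choice_def)
  qed
  have "W \<subseteq> (\<Union>m\<in>MS. {x. good x m})"
  proof
    fix x assume "x \<in> W"
    then have "{m \<in> MS. good x m} \<noteq> {}" using many[of x] by force
    then show "x \<in> (\<Union>m\<in>MS. {x. good x m})" by blast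
  qed
  then show finW: "finite W" using finMS few finite_subset[of W] by blast
  have "card W * (k - ?n + 1) = (\<Sum>x\<in>W. k - ?n + 1)" by simp
  also have "\<dots> \<le> (\<Sum>x\<in>W. card {m \<in> MS. good x m})" by (intro sum_mono many)
  also have "\<dots> = (\<Sum>m\<in>MS. card {x \<in> W. good x m})"
    by (rule sum_multicount_gen[symmetric]) (use finW finMS in auto)
  also have "\<dots> \<le> (\<Sum>m\<in>MS. d ^ ?n)"
  proof (rule sum_mono)
    fix m assume "m \<in> MS"
    then have "card {x \<in> W. good x m} \<le> card {x. good x m}" using few by (intro card_mono) auto
    then show "card {x \<in> W. good x m} \<le> d ^ ?n" using few[OF \<open>m \<in> MS\<close>] by simp
  qed
  also have "\<dots> = ((k + ?n - 1) choose ?n) * d ^ ?n"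
    by (simp add: MS_def card_multisets_of_size)
  finally show "card W * (k - ?n + 1) \<le> ((k + ?n - 1) choose ?n) * d ^ ?n" .
qed

section \<open>The cells of a tropical prevariety\<close>

text \<open>
  The closed cell of \<open>x\<close>: every monomial that is minimal at \<open>x\<close> stays minimal.
\<close>

definition pattern_cell :: "nat \<Rightarrow> (nat \<Rightarrow> ('a::euclidean_space \<times> real) set) \<Rightarrow> 'a \<Rightarrow> 'a set" where
  "pattern_cell k N x = {y. \<forall>i<k. argmins (N i) x \<subseteq> argmins (N i) y}"

lemma self_in_pattern_cell: "x \<in> pattern_cell k N x"
  by (simp add: pattern_cell_def)

lemma polyhedron_pattern_cell:
  assumes "\<And>i. i < k \<Longrightarrow> finite (N i)"
  shows "polyhedron (pattern_cell k N x)"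
proof -
  define H where "H = (\<lambda>m m'. {y :: 'a. (fst m - fst m') \<bullet> y \<le> snd m' - snd m})"
  have "pattern_cell k N x = \<Inter>(\<Union>i<k. \<Union>m\<in>argmins (N i) x. H m ` N i)"
  proof -
    have "argmins (N i) x \<subseteq> argmins (N i) y \<longleftrightarrow> (\<forall>m\<in>argmins (N i) x. \<forall>m'\<in>N i. y \<in> H m m')" for i y
    proof -
      have H: "z \<in> H m m' \<longleftrightarrow> affine_value z m \<le> affine_value z m'" for z m m'
        unfolding H_def affine_value_def by (simp add: inner_diff_left) linarith
      have "m \<in> argmins (N i) y \<longleftrightarrow> (\<forall>m'\<in>N i. y \<in> H m m')" if "m \<in> argmins (N i) x" for m
        using that argmins_subset[of "N i" x] unfolding H argmins_def[of "N i" y] by blast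
      then show ?thesis by blast
    qed
    then show ?thesis by (auto simp: pattern_cell_def)
  qed
  then have eq: "pattern_cell k N x = \<Inter>(\<Union>i<k. \<Union>m\<in>argmins (N i) x. H m ` N i)" .
  have "finite (\<Union>i<k. \<Union>m\<in>argmins (N i) x. H m ` N i)"
    using assms by (auto intro!: finite_subset[OF argmins_subset])
  moreover have "polyhedron S" if "S \<in> (\<Union>i<k. \<Union>m\<in>argmins (N i) x. H m ` N i)" for S
    using that by (auto simp: H_def polyhedron_halfspace_le)
  ultimately show ?thesis unfolding eq by (rule polyhedron_Inter)
qed

text \<open>
  If a monomial is minimal at an inner point of a segment along which another monomial is minimal, the
  difference of the two is nonnegative at the ends and zero inside, so it vanishes on the segment.
\<close>

lemma pattern_cells_inter_face:
  assumes N: "\<And>i. i < k \<Longrightarrow> finite (N i)" "\<And>i. i < k \<Longrightarrow> N i \<noteq> {}"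
  shows "pattern_cell k N x \<inter> pattern_cell k N y face_of pattern_cell k N x"
  unfolding face_of_def
proof (intro conjI ballI impI)
  show "convex (pattern_cell k N x \<inter> pattern_cell k N y)"
    using N(1) by (intro polyhedron_imp_convex polyhedron_Int polyhedron_pattern_cell)
  fix a b z assume a: "a \<in> pattern_cell k N x" and b: "b \<in> pattern_cell k N x"
    and z: "z \<in> pattern_cell k N x \<inter> pattern_cell k N y" "z \<in> open_segment a b"
  obtain t where t: "0 < t" "t < 1" "z = (1 - t) *\<^sub>R a + t *\<^sub>R b" using z(2) by (auto simp: in_segment)
  have "m \<in> argmins (N i) a \<and> m \<in> argmins (N i) b" if i: "i < k" and m: "m \<in> argmins (N i) y" for i m
  proof -
    \<comment> \<open>A monomial that is minimal on the whole cell of \<open>x\<close>, to compare with.\<close>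
    obtain m0 where m0: "m0 \<in> argmins (N i) x" using argmins_nonempty[OF N[OF i]] by blast
    have m0': "m0 \<in> argmins (N i) a" "m0 \<in> argmins (N i) b" "m0 \<in> argmins (N i) z"
      using a b z(1) m0 i by (auto simp: pattern_cell_def)
    have mz: "m \<in> argmins (N i) z" using z(1) m i by (auto simp: pattern_cell_def)
    have mN: "m \<in> N i" using m argmins_subset by blast
    define \<delta> where "\<delta> = (\<lambda>y. affine_value y m - affine_value y m0)"
    have "\<delta> a \<ge> 0" "\<delta> b \<ge> 0" using m0'(1,2) mN by (auto simp: \<delta>_def argmins_def)
    moreover have "\<delta> z = 0" using argmins_eq_iff[OF m0'(3)] mz by (auto simp: \<delta>_def)
    moreover have "\<delta> z = (1 - t) * \<delta> a + t * \<delta> b"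
      unfolding t(3) \<delta>_def affine_value_def by (simp add: algebra_simps)
    ultimately have "(1 - t) * \<delta> a = 0" "t * \<delta> b = 0"
      using t(1,2) add_nonneg_eq_0_iff[of "(1 - t) * \<delta> a" "t * \<delta> b"] by simp_all
    then have "\<delta> a = 0" "\<delta> b = 0" using t(1,2) by auto
    then show ?thesis using argmins_eq_iff[OF m0'(1)] argmins_eq_iff[OF m0'(2)] mN by (auto simp: \<delta>_def)
  qed
  then show "a \<in> pattern_cell k N x \<inter> pattern_cell k N y" "b \<in> pattern_cell k N x \<inter> pattern_cell k N y"
    using a b by (auto simp: pattern_cell_def)
qed auto

lemma finite_pattern_cells:
  assumes "\<And>i. i < k \<Longrightarrow> finite (N i)"
  shows "finite (range (pattern_cell k N))"
proof -
  have "range (pattern_cell k N) \<subseteq> (\<lambda>P. {y. \<forall>i<k. P i \<subseteq> argmins (N i) y}) ` PiE {..<k} (\<lambda>i. Pow (N i))"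
  proof (rule image_subsetI)
    fix x
    have "pattern_cell k N x = (\<lambda>P. {y. \<forall>i<k. P i \<subseteq> argmins (N i) y}) (\<lambda>i\<in>{..<k}. argmins (N i) x)"
      by (auto simp: pattern_cell_def)
    moreover have "(\<lambda>i\<in>{..<k}. argmins (N i) x) \<in> PiE {..<k} (\<lambda>i. Pow (N i))"
      using argmins_subset by (auto simp: PiE_iff)
    ultimately show "pattern_cell k N x \<in> (\<lambda>P. {y. \<forall>i<k. P i \<subseteq> argmins (N i) y}) ` PiE {..<k} (\<lambda>i. Pow (N i))"
      by (rule image_eqI)
  qed
  moreover have "finite (PiE {..<k} (\<lambda>i. Pow (N i)))" using assms by (intro finite_PiE) auto
  ultimately show ?thesis by (rule finite_surj[rotated])
qed

text \<open>
  Moving orthogonally to all differences keeps the minimal exponents tied, and the other monomials stay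
  above them for a short while.
\<close>

lemma argmins_stable_direction:
  assumes "finite M" and u: "\<And>p q. p \<in> dual_cell M v \<Longrightarrow> q \<in> dual_cell M v \<Longrightarrow> u \<bullet> (q - p) = 0"
  shows "\<forall>\<^sub>F t in at_right (0::real). argmins M v \<subseteq> argmins M (v + t *\<^sub>R u)"
proof -
  have "\<forall>\<^sub>F t in at_right (0::real). affine_value (v + t *\<^sub>R u) m \<le> affine_value (v + t *\<^sub>R u) m'"
    if m: "m \<in> argmins M v" and m': "m' \<in> M" for m m'
  proof (cases "m' \<in> argmins M v")
    case True
    then have "u \<bullet> (fst m' - fst m) = 0" using m by (intro u) auto
    moreover have "affine_value v m' = affine_value v m" using argmins_eq_iff[OF m] True by auto
    ultimately have "affine_value (v + t *\<^sub>R u) m \<le> affine_value (v + t *\<^sub>R u) m'" for t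
      by (simp add: affine_value_def algebra_simps inner_commute)
    then show ?thesis by simp
  next
    case False
    then have lt: "affine_value v m < affine_value v m'"
      using argmins_eq_iff[OF m] m m' by (force simp: argmins_def less_le)
    have "((\<lambda>t. affine_value (v + t *\<^sub>R u) m' - affine_value (v + t *\<^sub>R u) m)
        \<longlongrightarrow> affine_value (v + 0 *\<^sub>R u) m' - affine_value (v + 0 *\<^sub>R u) m) (at_right 0)"
      unfolding affine_value_def by (intro tendsto_intros)
    then have "\<forall>\<^sub>F t in at_right (0::real). 0 < affine_value (v + t *\<^sub>R u) m' - affine_value (v + t *\<^sub>R u) m"
      by (rule order_tendstoD(1)) (use lt in simp)
    then show ?thesis by eventually_elim simp
  qed
  then have "\<forall>\<^sub>F t in at_right (0::real). \<forall>m\<in>argmins M v. \<forall>m'\<in>M. affine_value (v + t *\<^sub>R u) m \<le> affine_value (v + t *\<^sub>R u) m'"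
    using assms(1) finite_subset[OF argmins_subset assms(1)] by (simp add: eventually_ball_finite)
  then show ?thesis
  proof eventually_elim
    case (elim t)
    then show ?case using argmins_subset[of M v] by (auto simp: argmins_def)
  qed
qed

text \<open>
  Otherwise some direction is orthogonal to all differences, and \<open>v\<close> can be moved a little both ways
  inside the cell.
\<close>

lemma extreme_point_of_pattern_cell:
  assumes N: "\<And>i. i < k \<Longrightarrow> finite (N i)" and v: "v extreme_point_of pattern_cell k N x"
  shows "span (\<Union>i<k. {q - p | p q. p \<in> dual_cell (N i) v \<and> q \<in> dual_cell (N i) v}) = UNIV"
proof (rule ccontr)
  let ?D = "\<Union>i<k. {q - p | p q. p \<in> dual_cell (N i) v \<and> q \<in> dual_cell (N i) v}"
  assume "span ?D \<noteq> UNIV"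
  then obtain u where u: "u \<noteq> 0" "span ?D \<subseteq> {w. u \<bullet> w = 0}"
    using span_not_univ_subset_hyperplane[of ?D] by blast
  have orth: "u \<bullet> (q - p) = 0" if "i < k" "p \<in> dual_cell (N i) v" "q \<in> dual_cell (N i) v" for i p q
  proof -
    have "q - p \<in> span ?D" using that by (intro span_base) blast
    then show ?thesis using u(2) by blast
  qed
  have stable: "\<forall>\<^sub>F t in at_right (0::real). v + t *\<^sub>R w \<in> pattern_cell k N x" if w: "w = u \<or> w = - u" for w
  proof -
    have "\<forall>\<^sub>F t in at_right (0::real). argmins (N i) v \<subseteq> argmins (N i) (v + t *\<^sub>R w)" if "i < k" for i
    proof (rule argmins_stable_direction[OF N[OF that]])
      fix p q assume "p \<in> dual_cell (N i) v" "q \<in> dual_cell (N i) v"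
      then have "u \<bullet> (q - p) = 0" by (rule orth[OF that])
      then show "w \<bullet> (q - p) = 0" using w by (elim disjE) simp_all
    qed
    then have "\<forall>\<^sub>F t in at_right (0::real). \<forall>i\<in>{..<k}. argmins (N i) v \<subseteq> argmins (N i) (v + t *\<^sub>R w)"
      by (intro eventually_ball_finite) auto
    moreover have "v \<in> pattern_cell k N x" using v by (simp add: extreme_point_of_def)
    ultimately show ?thesis by (elim eventually_mono) (force simp: pattern_cell_def)
  qed
  have "\<forall>\<^sub>F t in at_right (0::real). 0 < t" by (simp add: eventually_at_right_less)
  with stable[of u] stable[of "- u"] have "\<forall>\<^sub>F t in at_right (0::real). 0 < t \<and> v + t *\<^sub>R u \<in> pattern_cell k N x
     \<and> v + t *\<^sub>R (- u) \<in> pattern_cell k N x" by (simp add: eventually_conj)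
  then obtain t :: real where t: "0 < t" "v + t *\<^sub>R u \<in> pattern_cell k N x" "v + t *\<^sub>R (- u) \<in> pattern_cell k N x"
    using eventually_happens'[OF trivial_limit_at_right_real] by blast
  have "v = (1 - 1/2) *\<^sub>R (v + t *\<^sub>R u) + (1/2) *\<^sub>R (v + t *\<^sub>R (- u))" by (simp add: algebra_simps flip: scaleR_add_left)
  moreover have "v + t *\<^sub>R u \<noteq> v + t *\<^sub>R (- u)"
  proof
    assume "v + t *\<^sub>R u = v + t *\<^sub>R (- u)"
    then have "(2 * t) *\<^sub>R u = 0" by (simp add: algebra_simps scaleR_2 flip: scaleR_scaleR)
    then show False using u(1) t(1) by simp
  qed
  ultimately have "v \<in> open_segment (v + t *\<^sub>R u) (v + t *\<^sub>R (- u))"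
    unfolding in_segment by (intro conjI exI[of _ "1/2"]) simp_all
  then show False using v t(2,3) by (auto simp: extreme_point_of_def)
qed

lemma polytopal_complex_pattern_cells:
  assumes N: "\<And>i. i < k \<Longrightarrow> finite (N i)" "\<And>i. i < k \<Longrightarrow> N i \<noteq> {}"
    and bounded: "\<And>x. x \<in> V \<Longrightarrow> bounded (pattern_cell k N x)"
  shows "polytopal_complex {F. \<exists>x\<in>V. F face_of pattern_cell k N x}"
  unfolding polytopal_complex_def
proof (intro conjI ballI allI impI)
  have poly: "polytope (pattern_cell k N x)" if "x \<in> V" for x
    using bounded[OF that] polyhedron_pattern_cell[of k N x] N(1) by (simp add: polytope_eq_bounded_polyhedron)
  have eq: "{F. \<exists>x\<in>V. F face_of pattern_cell k N x} = (\<Union>K\<in>pattern_cell k N ` V. {F. F face_of K})" by auto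
  have fin: "finite (pattern_cell k N ` V)" using finite_pattern_cells[of k N] N(1)
    by (meson finite_subset image_mono subset_UNIV)
  show "finite {F. \<exists>x\<in>V. F face_of pattern_cell k N x}"
    unfolding eq
  proof (rule finite_UN_I[OF fin])
    fix K assume "K \<in> pattern_cell k N ` V"
    then have "polytope K" using poly by blast
    then show "finite {F. F face_of K}" by (rule finite_polytope_faces)
  qed
  fix S assume S: "S \<in> {F. \<exists>x\<in>V. F face_of pattern_cell k N x}"
  then obtain x where x: "x \<in> V" "S face_of pattern_cell k N x" by blast
  show "polytope S" using x poly face_of_polytope_polytope by blast
  show "F \<in> {F. \<exists>x\<in>V. F face_of pattern_cell k N x}" if "F face_of S" for F
    using that x face_of_trans by blast
  fix T assume "T \<in> {F. \<exists>x\<in>V. F face_of pattern_cell k N x}"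
  then obtain y where y: "y \<in> V" "T face_of pattern_cell k N y" by blast
  show "S \<inter> T face_of S"
    using face_of_Int_subface[OF pattern_cells_inter_face[where x = x and y = y, OF N] _ x(2) y(2)]
      pattern_cells_inter_face[where x = y and y = x, OF N] by (simp add: Int_commute)
qed

definition exponent_vector :: "nat ^ 'n \<Rightarrow> real ^ 'n::finite" where
  "exponent_vector I = (\<chi> j. real (I $ j))"

definition monomial_points :: "'n::finite trop_poly \<Rightarrow> ((real ^ 'n) \<times> real) set" where
  "monomial_points f = (\<lambda>I. (exponent_vector I, the (f I))) ` dom f"

lemma exponent_vector_eq_iff: "exponent_vector I = exponent_vector J \<longleftrightarrow> I = J"
  by (auto simp: exponent_vector_def vec_eq_iff)

lemma affine_value_monomial: "affine_value x (exponent_vector I, the (f I)) = trop_monomial f I x"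
  by (simp add: affine_value_def trop_monomial_def exponent_vector_def inner_vec_def)

lemma trop_zero_iff:
  assumes "is_trop_poly f"
  shows "trop_zero f x \<longleftrightarrow> (\<exists>p\<in>dual_cell (monomial_points f) x. \<exists>q\<in>dual_cell (monomial_points f) x. p \<noteq> q)"
proof -
  have fin: "finite (dom f)" and ne: "dom f \<noteq> {}" using assms by (auto simp: is_trop_poly_def)
  have iff: "(\<forall>J\<in>dom f. trop_monomial f I x \<le> trop_monomial f J x) \<longleftrightarrow> trop_monomial f I x = trop_eval f x"
    if "I \<in> dom f" for I
  proof
    assume "\<forall>J\<in>dom f. trop_monomial f I x \<le> trop_monomial f J x"
    then show "trop_monomial f I x = trop_eval f x"
      unfolding trop_eval_def using fin that by (intro Min_eqI[symmetric]) auto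
  next
    assume "trop_monomial f I x = trop_eval f x"
    then show "\<forall>J\<in>dom f. trop_monomial f I x \<le> trop_monomial f J x"
      unfolding trop_eval_def using fin by simp
  qed
  define g where "g = (\<lambda>I. (exponent_vector I, the (f I)))"
  have "argmins (g ` dom f) x = g ` {I \<in> dom f. \<forall>J\<in>dom f. affine_value x (g I) \<le> affine_value x (g J)}"
    unfolding argmins_def by blast
  also have "\<dots> = g ` {I \<in> dom f. trop_monomial f I x = trop_eval f x}"
    unfolding g_def affine_value_monomial using iff by (metis (no_types, lifting))
  finally have "argmins (monomial_points f) x
      = (\<lambda>I. (exponent_vector I, the (f I))) ` {I \<in> dom f. trop_monomial f I x = trop_eval f x}"
    by (simp add: monomial_points_def g_def)
  then have "dual_cell (monomial_points f) x = exponent_vector ` {I \<in> dom f. trop_monomial f I x = trop_eval f x}"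
    by (simp add: image_image)
  then show ?thesis by (auto simp: trop_zero_def exponent_vector_eq_iff)
qed

lemma fst_monomial_points:
  assumes "is_trop_poly f" "finite_coefficients f"
  shows "fst ` monomial_points f = lattice_simplex (trop_degree f)"
proof -
  have fin: "finite (dom f)" using assms by (auto simp: is_trop_poly_def)
  have dom: "I \<in> dom f \<longleftrightarrow> monomial_degree I \<le> trop_degree f" for I
  proof
    assume "I \<in> dom f"
    then show "monomial_degree I \<le> trop_degree f" unfolding trop_degree_def using fin by simp
  next
    assume "monomial_degree I \<le> trop_degree f"
    then show "I \<in> dom f" using assms(2) unfolding finite_coefficients_def by blast
  qed
  have "fst ` monomial_points f = exponent_vector ` dom f" by (simp add: monomial_points_def image_image)
  also have "\<dots> = lattice_simplex (trop_degree f)"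
  proof (intro equalityI subsetI)
    fix q assume "q \<in> exponent_vector ` dom f"
    then obtain I where I: "q = exponent_vector I" "I \<in> dom f" by blast
    have "(\<Sum>i\<in>UNIV. q $ i) = real (monomial_degree I)"
      by (simp add: I exponent_vector_def monomial_degree_def)
    then show "q \<in> lattice_simplex (trop_degree f)"
      using I dom by (auto simp: lattice_simplex_def exponent_vector_def)
  next
    fix q :: "real ^ 'a" assume q: "q \<in> lattice_simplex (trop_degree f)"
    then have "\<forall>i. \<exists>m. q $ i = real m" by (auto simp: lattice_simplex_def elim!: Nats_cases)
    then obtain h where h: "\<And>i. q $ i = real (h i)" by metis
    have "q = exponent_vector (\<chi> i. h i)" by (simp add: exponent_vector_def vec_eq_iff h)
    moreover have "real (monomial_degree (\<chi> i. h i)) \<le> real (trop_degree f)"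
      using q by (simp add: lattice_simplex_def monomial_degree_def h)
    ultimately show "q \<in> exponent_vector ` dom f" using dom by auto
  qed
  finally show ?thesis .
qed

theorem theorem6p6:
  fixes F :: "nat \<Rightarrow> 'n::finite trop_poly" and V :: "(real ^ 'n) set" and k d l :: nat
  assumes "CARD('n) \<le> k"
    and "\<And>i. i < k \<Longrightarrow> is_trop_poly (F i)"
    and "\<And>i. i < k \<Longrightarrow> finite_coefficients (F i)"
    and "\<And>i. i < k \<Longrightarrow> trop_degree (F i) \<le> d"
    and "V = trop_prevariety k F"
    and "compact V"
    and "l \<le> CARD('n)"
  shows "ereal_of_enat (betti_number l V)
    \<le> ereal ((real d ^ CARD('n) / (real k - real CARD('n) + 1)
              * real ((k + CARD('n) - 1) choose CARD('n))) ^ (l + 1))"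
proof -
  define N where "N = (\<lambda>i. monomial_points (F i))"
  define \<M> where "\<M> = {C. \<exists>x\<in>V. C face_of pattern_cell k N x}"
  define W where "W = {v. {v} \<in> \<M>}"
  have N: "finite (N i)" "N i \<noteq> {}" if "i < k" for i
    using assms(2)[OF that] unfolding N_def monomial_points_def is_trop_poly_def by simp_all
  have V: "x \<in> V \<longleftrightarrow> (\<forall>i<k. \<exists>p\<in>dual_cell (N i) x. \<exists>q\<in>dual_cell (N i) x. p \<noteq> q)" for x
    unfolding assms(5) trop_prevariety_def N_def using trop_zero_iff[OF assms(2)] by auto
  have cellV: "pattern_cell k N x \<subseteq> V" if "x \<in> V" for x
  proof
    fix y assume y: "y \<in> pattern_cell k N x"
    show "y \<in> V"
      unfolding V
    proof (intro allI impI)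
      fix i assume i: "i < k"
      then have "argmins (N i) x \<subseteq> argmins (N i) y" using y by (simp add: pattern_cell_def)
      then have sub: "dual_cell (N i) x \<subseteq> dual_cell (N i) y" by (rule image_mono)
      have "\<exists>p\<in>dual_cell (N i) x. \<exists>q\<in>dual_cell (N i) x. p \<noteq> q" using that V[of x] i by simp
      then show "\<exists>p\<in>dual_cell (N i) y. \<exists>q\<in>dual_cell (N i) y. p \<noteq> q" using sub by (meson subsetD)
    qed
  qed
  have complex: "polytopal_complex \<M>"
    unfolding \<M>_def
    by (rule polytopal_complex_pattern_cells[OF N bounded_subset[OF compact_imp_bounded[OF assms(6)] cellV]])
  have union: "\<Union>\<M> = V"
  proof
    show "\<Union>\<M> \<subseteq> V" using cellV face_of_imp_subset unfolding \<M>_def by blast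
    show "V \<subseteq> \<Union>\<M>"
    proof
      fix x assume "x \<in> V"
      moreover have "pattern_cell k N x face_of pattern_cell k N x"
        using N(1) by (intro face_of_refl polyhedron_imp_convex polyhedron_pattern_cell)
      ultimately show "x \<in> \<Union>\<M>" using self_in_pattern_cell[of x k N] unfolding \<M>_def by blast
    qed
  qed
  have count: "card W * (k - CARD('n) + 1) \<le> ((k + CARD('n) - 1) choose CARD('n)) * d ^ CARD('n)"
  proof (rule card_tropical_vertices(2)[where N = N and e = "\<lambda>i. trop_degree (F i)"])
    show "fst ` N i = lattice_simplex (trop_degree (F i))" if "i < k" for i
      unfolding N_def using assms(2,3)[OF that] by (rule fst_monomial_points)
  next
    fix x i assume x: "x \<in> W" and i: "i < k"
    then have "x \<in> V" using union by (auto simp: W_def)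
    then show "\<exists>p\<in>dual_cell (N i) x. \<exists>q\<in>dual_cell (N i) x. p \<noteq> q" using V[of x] i by simp
  next
    fix x assume "x \<in> W"
    then obtain y where "x extreme_point_of pattern_cell k N y" by (auto simp: W_def \<M>_def face_of_singleton)
    then show "span (\<Union>i<k. {q - p | p q. p \<in> dual_cell (N i) x \<and> q \<in> dual_cell (N i) x}) = UNIV"
      using N(1) by (rule extreme_point_of_pattern_cell[rotated])
  qed (use N assms in auto)
  define b where "b = real d ^ CARD('n) / (real k - real CARD('n) + 1) * real ((k + CARD('n) - 1) choose CARD('n))"
  have pos: "real k - real CARD('n) + 1 > 0" using assms(1) by simp
  have "real (card W) * (real k - real CARD('n) + 1) = real (card W * (k - CARD('n) + 1))"
  proof -
    have "real (k - CARD('n) + 1) = real k - real CARD('n) + 1" using assms(1) by simp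
    then show ?thesis by (simp only: of_nat_mult)
  qed
  also have "\<dots> \<le> real (((k + CARD('n) - 1) choose CARD('n)) * d ^ CARD('n))" using count by linarith
  finally have "real (card W) * (real k - real CARD('n) + 1) \<le> real ((k + CARD('n) - 1) choose CARD('n)) * real d ^ CARD('n)"
    by simp
  then have Wb: "real (card W) \<le> b" using pos by (simp add: b_def pos_le_divide_eq mult.commute)
  have "betti_number l V \<le> enat (card {S \<in> \<M>. aff_dim S = int l})"
    using betti_number_polytopal_complex[OF complex, of l] union by simp
  also have "\<dots> \<le> enat (card W ^ (l + 1))"
    using card_faces_le_vertices_power[OF complex, of l] by (simp add: W_def)
  finally have "ereal_of_enat (betti_number l V) \<le> ereal (real (card W ^ (l + 1)))"
    by (metis ereal_of_enat_le_iff ereal_of_enat_simps(1))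
  also have "\<dots> \<le> ereal (b ^ (l + 1))" using power_mono[OF Wb, of "l + 1"] by simp
  finally show ?thesis unfolding b_def .
qed

end
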